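(* Let $G$ be a finite cyclic group of order at least $250$. Then \[ \Delta^{\ast}(G) \cap \mathbb{N}_{\ge |G|/5} = \mathbb{N} \cap \left\{ |G|-2, \tfrac{|G|-2}{2}, \tfrac{|G|-3}{2}, \tfrac{|G|-4}{2}, \tfrac{|G|-4}{3}, \tfrac{|G|-6}{3}, \tfrac{|G|-4}{4}, \tfrac{|G|-5}{4}, \tfrac{|G|-6}{4}, \tfrac{|G|-8}{4} \right\}. \]
   Context: $\mathbb{N}$ denotes the positive integers and $\mathbb{N}_{\ge a}=\{k\in\mathbb{N}: k\ge a\}$. For an additive abelian group $G$ and $G_0\subseteq G$, a sequence over $G_0$ is an element of the free abelian monoid on $G_0$ (a finite unordered list of elements of $G_0$, repetitions allowed). $\mathcal{B}(G_0)$ is the monoid of zero-sum sequences over $G_0$ (including the empty sequence); its irreducible elements are the minimal zero-sum sequences (non-empty zero-sum sequences having no proper non-empty zero-sum subsequence). For $B\in\mathcal B(G_0)$, $\mathsf L(B)$ is the set of all $\ell\ge 0$ such that $B$ is a product of $\ell$ minimal zero-sum sequences. For a finite set of integers $L=\{\ell_1<\dots<\ell_k\}$ let $\Delta(L)=\{\ell_{i+1}-\ell_i: 1\le i<k\}$; $\Delta(G_0)=\bigcup_{B\in\mathcal B(G_0)}\Delta(\mathsf L(B))$, and $\min\Delta(G_0)$ is its minimum, with the convention $\min\emptyset=0$. For a finite abelian group $G$, $\Delta^{\ast}(G)=\{\min\Delta(G_0): G_0\subseteq G,\ \Delta(G_0)\neq\emptyset\}$. *)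

theory Defs
  imports Complex_Main "HOL-Algebra.FiniteProduct" "HOL-Algebra.Elementary_Groups" "HOL-Library.Multiset"
begin

text \<open>
  Groups are those of HOL-Algebra and hence written multiplicatively: the sum of a sequence
  becomes a product in \<open>G\<close>, and ``zero-sum'' means that this product is the neutral element.
  A sequence over \<open>G\<^sub>0\<close> is a finite multiset with elements in \<open>G\<^sub>0\<close>; the product of
  sequences is multiset addition and the subsequence relation is multiset inclusion.
\<close>

definition seq_sum :: "('a, 'b) monoid_scheme \<Rightarrow> 'a multiset \<Rightarrow> 'a" where
  "seq_sum G S = finprod G (\<lambda>g. g [^]\<^bsub>G\<^esub> count S g) (set_mset S)"

definition zero_sum_seqs :: "('a, 'b) monoid_scheme \<Rightarrow> 'a set \<Rightarrow> 'a multiset set" where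
  "zero_sum_seqs G G\<^sub>0 = {S. set_mset S \<subseteq> G\<^sub>0 \<and> seq_sum G S = \<one>\<^bsub>G\<^esub>}"

definition minimal_zero_sum_seqs :: "('a, 'b) monoid_scheme \<Rightarrow> 'a set \<Rightarrow> 'a multiset set" where
  "minimal_zero_sum_seqs G G\<^sub>0 =
     {A \<in> zero_sum_seqs G G\<^sub>0. A \<noteq> {#} \<and>
        \<not> (\<exists>T \<in> zero_sum_seqs G G\<^sub>0. T \<noteq> {#} \<and> T \<subset># A)}"

definition length_set :: "('a, 'b) monoid_scheme \<Rightarrow> 'a set \<Rightarrow> 'a multiset \<Rightarrow> nat set" where
  "length_set G G\<^sub>0 B =
     {l. \<exists>F. set_mset F \<subseteq> minimal_zero_sum_seqs G G\<^sub>0 \<and> \<Sum>\<^sub># F = B \<and> size F = l}"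

text \<open>
  The next definition is meaningful for finite \<open>L\<close> only; length sets are always finite, see below.
\<close>

definition successive_distances :: "nat set \<Rightarrow> nat set" where
  "successive_distances L =
     (let ls = sorted_list_of_set L in {ls ! Suc i - ls ! i | i. Suc i < length ls})"

definition Delta :: "('a, 'b) monoid_scheme \<Rightarrow> 'a set \<Rightarrow> nat set" where
  "Delta G G\<^sub>0 = (\<Union>B \<in> zero_sum_seqs G G\<^sub>0. successive_distances (length_set G G\<^sub>0 B))"

definition min_Delta :: "('a, 'b) monoid_scheme \<Rightarrow> 'a set \<Rightarrow> nat" where
  "min_Delta G G\<^sub>0 = (if Delta G G\<^sub>0 = {} then 0 else LEAST d. d \<in> Delta G G\<^sub>0)"

definition Delta_star :: "('a, 'b) monoid_scheme \<Rightarrow> nat set" where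
  "Delta_star G = {min_Delta G G\<^sub>0 | G\<^sub>0. G\<^sub>0 \<subseteq> carrier G \<and> Delta G G\<^sub>0 \<noteq> {}}"

lemma finite_length_set: "finite (length_set G G\<^sub>0 B)"
proof -
  have "size F \<le> size (\<Sum>\<^sub># F)" if "set_mset F \<subseteq> minimal_zero_sum_seqs G G\<^sub>0" for F
    using that
  proof (induction F)
    case (add A F)
    then have "A \<noteq> {#}"
      by (simp add: minimal_zero_sum_seqs_def)
    then have "1 \<le> size A"
      by (simp add: Suc_le_eq nonempty_has_size)
    with add show ?case by simp
  qed simp
  then have "length_set G G\<^sub>0 B \<subseteq> {..size B}"
    by (auto simp: length_set_def)
  then show ?thesis
    by (rule finite_subset) simp
qed

end

(*
  Let d be the minimal distance of X, so that all lengths of an element of B(X) agree modulo d,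
  and let d >= n/5. For g, h in X let t = gcd (ord g) (ord h). The subgroup of order t is generated
  by the multiple f of g and by the multiple a f of h of order t. If a = 1 for all pairs, then
  X = {w e : w in W} for some e and some set W of divisors of n, every atom has cross number at
  least 1, and comparing an atom U with its complement in the product of the h^(ord h), h in
  supp U, gives cross number exactly 1: X is half-factorial. Hence a > 1 for some pair. With
  respect to f, the index of every atom over {f, a f} is 1 modulo d. Writing out the first atom
  whose index differs from 1 (one step of the Euclidean algorithm for t and a) gives
  t = 4d + 4, or a = -c or 1/a = -c modulo t with c <= 4 and cd | t - c - 1. Since t divides n and
  n <= 5d, only the listed values remain, together with three spurious ones that are excluded by
  determining the further elements of X. Conversely, the values are attained by {e, -c e} and
  {e, -e, (m/2) e} in the subgroup of order m, with e a generator of it.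
*)
theory Submission
  imports Defs "HOL-Number_Theory.Cong" "HOL-Computational_Algebra.Primes"
    "HOL-Algebra.Multiplicative_Group"
begin

section \<open>Distances and congruences between lengths\<close>

text \<open>"Minimal distance d" splits into two conditions of different nature:
  \<open>lengths_cong\<close> is inherited by every subset of X, \<open>has_distance\<close> is not.
  Small subsets can restrict d only through the first one, and this shapes the proof in two places.
  If all pairs are compatible, no pair gives any restriction; there the size of n enters, because
  the support of an atom has at most as many elements as n has divisors, and n has at most d of
  them. The three spurious values pass the test on the pair {e, -e} or {e, -2 e} that produces them,
  as such a pair has a proper multiple of d as its minimal distance; refuting them takes all
  elements of X. A further obstacle is that X need not contain a generator of G, whereas the index
  of an atom is tied to its length only in the presence of an element of weight 1. Each pair is
  therefore moved into the intersection of the two cyclic subgroups generated by its elements, where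
  a multiple of either element is a generator.\<close>

definition atoms :: "'a multiset set \<Rightarrow> 'a multiset set" where
  "atoms Z = {A \<in> Z. A \<noteq> {#} \<and> \<not> (\<exists>T \<in> Z. T \<noteq> {#} \<and> T \<subset># A)}"

definition lengths_cong :: "nat \<Rightarrow> 'a multiset set \<Rightarrow> bool" where
  "lengths_cong d Z \<longleftrightarrow>
     (\<forall>F F'. set_mset F \<subseteq> atoms Z \<longrightarrow> set_mset F' \<subseteq> atoms Z \<longrightarrow> \<Sum>\<^sub># F = \<Sum>\<^sub># F' \<longrightarrow>
        [size F = size F'] (mod d))"

definition has_distance :: "nat \<Rightarrow> 'a multiset set \<Rightarrow> bool" where
  "has_distance d Z \<longleftrightarrow>
     (\<exists>F F'. set_mset F \<subseteq> atoms Z \<and> set_mset F' \<subseteq> atoms Z \<and> \<Sum>\<^sub># F = \<Sum>\<^sub># F' \<and>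
        size F' = size F + d)"

lemma lengths_congD:
  assumes "lengths_cong d Z" "set_mset F \<subseteq> atoms Z" "set_mset F' \<subseteq> atoms Z" "\<Sum>\<^sub># F = \<Sum>\<^sub># F'"
  shows "[size F = size F'] (mod d)"
  using assms unfolding lengths_cong_def by blast

lemma minimal_zero_sum_seqs_eq_atoms:
  "minimal_zero_sum_seqs G X = atoms (zero_sum_seqs G X)"
  by (simp add: minimal_zero_sum_seqs_def atoms_def)

lemma successive_distancesD:
  assumes "finite L" "\<delta> \<in> successive_distances L"
  shows "0 < \<delta> \<and> (\<exists>l\<in>L. l + \<delta> \<in> L)"
proof -
  define ls where "ls = sorted_list_of_set L"
  obtain i where i: "Suc i < length ls" "\<delta> = ls ! Suc i - ls ! i"
    using assms(2) unfolding successive_distances_def ls_def Let_def by blast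
  have "sorted_wrt (<) ls"
    unfolding ls_def by (simp add: strict_sorted_list_of_set)
  then have lt: "ls ! i < ls ! Suc i"
    using i(1) by (simp add: sorted_wrt_nth_less)
  have "set ls = L"
    using assms(1) by (simp add: ls_def)
  then have "ls ! i \<in> L" "ls ! Suc i \<in> L"
    using i(1) nth_mem[of i ls] nth_mem[of "Suc i" ls] by auto
  then show ?thesis
    using lt i(2) by (intro conjI bexI[of _ "ls ! i"]) auto
qed

lemma successive_distances_le:
  assumes "finite L" "l \<in> L" "m \<in> L" "l < m"
  shows "\<exists>\<delta>\<in>successive_distances L. \<delta> \<le> m - l"
proof -
  define ls where "ls = sorted_list_of_set L"
  have set: "set ls = L"
    using assms(1) by (simp add: ls_def)
  have sorted: "sorted ls"
    unfolding ls_def by simp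
  obtain i where i: "i < length ls" "ls ! i = l"
    using assms(2) set by (metis in_set_conv_nth)
  obtain j where j: "j < length ls" "ls ! j = m"
    using assms(3) set by (metis in_set_conv_nth)
  have "i < j"
    using sorted_nth_mono[OF sorted, of j i] i j assms(4) by (meson leD leI)
  then obtain k where k: "j = Suc k" "i \<le> k"
    by (cases j) auto
  have "l \<le> ls ! k"
    using sorted_nth_mono[OF sorted, of i k] i j k by simp
  moreover have "ls ! Suc k - ls ! k \<in> successive_distances L"
    using j k unfolding successive_distances_def ls_def[symmetric] Let_def by blast
  ultimately show ?thesis
    using j k by (intro bexI) auto
qed

lemma length_set_eq:
  "length_set G X B = {size F |F. set_mset F \<subseteq> atoms (zero_sum_seqs G X) \<and> \<Sum>\<^sub># F = B}"
  by (auto simp: length_set_def minimal_zero_sum_seqs_eq_atoms)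

lemma sum_mset_atoms_mem:
  assumes "{#} \<in> Z" "\<And>S T. S \<in> Z \<Longrightarrow> T \<in> Z \<Longrightarrow> S + T \<in> Z"
    and "set_mset F \<subseteq> atoms Z"
  shows "\<Sum>\<^sub># F \<in> Z"
  using assms(3)
proof (induction F)
  case empty
  then show ?case using assms(1) by simp
next
  case (add A F)
  then show ?case using assms(2)[of A "\<Sum>\<^sub># F"] by (auto simp: atoms_def)
qed

lemma sum_mset_repeat_mset: "\<Sum>\<^sub># (repeat_mset q F) = repeat_mset q (\<Sum>\<^sub># F)"
  by (induction q) auto

lemma set_mset_repeat_mset_subset: "set_mset (repeat_mset q F) \<subseteq> set_mset F"
  by (induction q) auto

lemma Delta_leI:
  assumes "{#} \<in> zero_sum_seqs G X"
    and "\<And>S T. S \<in> zero_sum_seqs G X \<Longrightarrow> T \<in> zero_sum_seqs G X \<Longrightarrow> S + T \<in> zero_sum_seqs G X"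
    and "has_distance r (zero_sum_seqs G X)" "0 < r"
  shows "\<exists>\<delta>\<in>Delta G X. \<delta> \<le> r"
proof -
  obtain F F' where F: "set_mset F \<subseteq> atoms (zero_sum_seqs G X)"
      "set_mset F' \<subseteq> atoms (zero_sum_seqs G X)" "\<Sum>\<^sub># F = \<Sum>\<^sub># F'" "size F' = size F + r"
    using assms(3) unfolding has_distance_def by blast
  let ?L = "length_set G X (\<Sum>\<^sub># F)"
  have "size F \<in> ?L" "size F' \<in> ?L"
    using F(1-3) unfolding length_set_eq mem_Collect_eq by metis+
  then obtain \<delta> where "\<delta> \<in> successive_distances ?L" "\<delta> \<le> size F' - size F"
    using successive_distances_le[OF finite_length_set, of "size F" G X "\<Sum>\<^sub># F" "size F'"]
      F(4) assms(4) by auto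
  moreover have "\<Sum>\<^sub># F \<in> zero_sum_seqs G X"
    using sum_mset_atoms_mem[OF assms(1,2) F(1)] .
  ultimately show ?thesis
    using F(4) unfolding Delta_def by auto
qed

lemma has_distance_of_Delta:
  assumes "\<delta> \<in> Delta G X"
  shows "0 < \<delta> \<and> has_distance \<delta> (zero_sum_seqs G X)"
proof -
  obtain B where "\<delta> \<in> successive_distances (length_set G X B)"
    using assms unfolding Delta_def by blast
  from successive_distancesD[OF finite_length_set this] obtain l
    where "0 < \<delta>" "l \<in> length_set G X B" "l + \<delta> \<in> length_set G X B"
    by blast
  then show ?thesis
    unfolding length_set_eq has_distance_def by (smt (verit) mem_Collect_eq)
qed

text \<open>The minimum of \<open>Delta\<close> is also its greatest common divisor: q copies of a
  pair of factorizations at distance d, set against a pair at distance m, produce the distance m mod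
  d, which would be smaller than d.\<close>

lemma min_Delta_eq_iff:
  assumes Z: "{#} \<in> zero_sum_seqs G X"
    "\<And>S T. S \<in> zero_sum_seqs G X \<Longrightarrow> T \<in> zero_sum_seqs G X \<Longrightarrow> S + T \<in> zero_sum_seqs G X"
    and "0 < d"
  shows "Delta G X \<noteq> {} \<and> min_Delta G X = d \<longleftrightarrow>
    lengths_cong d (zero_sum_seqs G X) \<and> has_distance d (zero_sum_seqs G X)"
proof
  let ?Z = "zero_sum_seqs G X"
  assume L: "Delta G X \<noteq> {} \<and> min_Delta G X = d"
  then have d: "d = (LEAST \<delta>. \<delta> \<in> Delta G X)"
    unfolding min_Delta_def by presburger
  then have dD: "d \<in> Delta G X"
    using L by (metis LeastI_ex ex_in_conv)
  have least: "d \<le> \<delta>" if "\<delta> \<in> Delta G X" for \<delta>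
    using that d by (simp add: Least_le)
  obtain E E' where E: "set_mset E \<subseteq> atoms ?Z" "set_mset E' \<subseteq> atoms ?Z"
      "\<Sum>\<^sub># E = \<Sum>\<^sub># E'" "size E' = size E + d"
    using has_distance_of_Delta[OF dD] unfolding has_distance_def by blast
  have dvd: "d dvd m" if F: "set_mset F \<subseteq> atoms ?Z" "set_mset F' \<subseteq> atoms ?Z"
      "\<Sum>\<^sub># F = \<Sum>\<^sub># F'" "size F' = size F + m" for F F' m
  proof (rule ccontr)
    assume "\<not> d dvd m"
    define q where "q = m div d"
    define K where "K = repeat_mset q E' + F"
    define K' where "K' = repeat_mset q E + F'"
    have r: "0 < m mod d" "m mod d < d"
      using \<open>\<not> d dvd m\<close> \<open>0 < d\<close> by (auto simp: dvd_eq_mod_eq_0)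
    have "size K' = size K + m mod d"
      using E(4) F(4) unfolding K_def K'_def q_def by (simp add: algebra_simps)
    moreover have "\<Sum>\<^sub># K = \<Sum>\<^sub># K'"
      using E(3) F(3) unfolding K_def K'_def by (simp add: sum_mset_repeat_mset)
    moreover have "set_mset K \<subseteq> atoms ?Z" "set_mset K' \<subseteq> atoms ?Z"
      using E(1,2) F(1,2) set_mset_repeat_mset_subset[of q E] set_mset_repeat_mset_subset[of q E']
      unfolding K_def K'_def by auto
    ultimately have "has_distance (m mod d) ?Z"
      unfolding has_distance_def by blast
    then show False
      using Delta_leI[OF Z _ r(1)] least r(2) by force
  qed
  have "[size F = size F'] (mod d)" if F: "set_mset F \<subseteq> atoms ?Z" "set_mset F' \<subseteq> atoms ?Z"
      "\<Sum>\<^sub># F = \<Sum>\<^sub># F'" for F F'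
  proof (cases "size F \<le> size F'")
    case True
    then show ?thesis
      using dvd[OF F, of "size F' - size F"] by (simp add: cong_altdef_nat cong_sym_eq[of "size F"])
  next
    case False
    then show ?thesis
      using dvd[OF F(2,1) F(3)[symmetric], of "size F - size F'"]
      by (simp add: cong_altdef_nat)
  qed
  then show "lengths_cong d ?Z \<and> has_distance d ?Z"
    using has_distance_of_Delta[OF dD] unfolding lengths_cong_def by blast
next
  let ?Z = "zero_sum_seqs G X"
  assume R: "lengths_cong d ?Z \<and> has_distance d ?Z"
  obtain \<delta> where \<delta>: "\<delta> \<in> Delta G X" "\<delta> \<le> d"
    using Delta_leI[OF Z _ \<open>0 < d\<close>] R by blast
  have ge: "d \<le> \<epsilon>" if \<epsilon>: "\<epsilon> \<in> Delta G X" for \<epsilon>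
  proof -
    obtain F F' where F: "set_mset F \<subseteq> atoms ?Z" "set_mset F' \<subseteq> atoms ?Z"
        "\<Sum>\<^sub># F = \<Sum>\<^sub># F'" "size F' = size F + \<epsilon>"
      using has_distance_of_Delta[OF \<epsilon>] unfolding has_distance_def by blast
    then have "[size F = size F + \<epsilon>] (mod d)"
      using R lengths_congD by metis
    then have "d dvd \<epsilon>"
      by (metis cong_add_lcancel_0_nat cong_0_iff cong_sym)
    then show ?thesis
      using has_distance_of_Delta[OF \<epsilon>] dvd_imp_le by blast
  qed
  have "\<delta> = d"
    using \<delta> ge[OF \<delta>(1)] by simp
  then have "(LEAST \<delta>. \<delta> \<in> Delta G X) = d"
    using \<delta>(1) ge by (intro Least_equality) auto
  then show "Delta G X \<noteq> {} \<and> min_Delta G X = d"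
    using \<delta>(1) by (auto simp: min_Delta_def)
qed

section \<open>Zero-sum sequences over two elements\<close>

lemma cong_1_nat_iff:
  fixes a d :: nat
  assumes "Suc 0 \<le> a"
  shows "[a = Suc 0] (mod d) \<longleftrightarrow> d dvd a - Suc 0"
  using assms by (simp add: cong_altdef_nat)

text \<open>
  A pair \<open>(i, j)\<close> stands for the sequence over \<open>\<int>/t\<int>\<close> with \<open>i\<close> terms \<open>1\<close> and \<open>j\<close> terms
  \<open>a\<close>, and \<open>z = (i + a j) / t\<close> is its index.
\<close>

definition minimal_pair :: "nat \<Rightarrow> nat \<Rightarrow> nat \<Rightarrow> nat \<Rightarrow> bool" where
  "minimal_pair t a x y \<longleftrightarrow> (x \<noteq> 0 \<or> y \<noteq> 0) \<and> t dvd x + a * y \<and>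
     (\<forall>x' y'. x' \<le> x \<longrightarrow> y' \<le> y \<longrightarrow> t dvd x' + a * y' \<longrightarrow> x' = 0 \<and> y' = 0 \<or> x' = x \<and> y' = y)"

text \<open>The trace of \<open>lengths_cong\<close> on a pair of elements. The atom of t terms 1
  and the atom of t - a terms 1 and one term a have index 1; comparison with these two turns lengths
  into indices.\<close>

definition index_cong :: "nat \<Rightarrow> nat \<Rightarrow> nat \<Rightarrow> bool" where
  "index_cong d t a \<longleftrightarrow>
     (\<forall>x y z. minimal_pair t a x y \<longrightarrow> x + a * y = z * t \<longrightarrow> [z = 1] (mod d))"

lemma index_congD:
  assumes "index_cong d t a" "minimal_pair t a x y" "x + a * y = z * t"
  shows "[z = 1] (mod d)"
  using assms unfolding index_cong_def by blast

text \<open>The t-fold repetition of a is an atom by coprimality, and its index is a.\<close>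

lemma index_cong_self:
  assumes "index_cong d t a" "coprime a t" "0 < t"
  shows "[a = 1] (mod d)"
proof (rule index_congD[OF assms(1), of 0 t])
  have "y = 0 \<or> y = t" if "y \<le> t" "t dvd a * y" for y
    using that assms(2) by (metis coprime_commute coprime_dvd_mult_right_iff dvd_imp_le gr0I le_antisym)
  then show "minimal_pair t a 0 t"
    using assms(3) by (auto simp: minimal_pair_def)
qed simp

text \<open>Here m + 1 is the least number of terms -c whose total reaches -t, and c (m + 1) - t < c
  terms 1 make up for the excess. This atom has index m: a zero-sum part with y \<le> m terms -c and
  x terms 1 satisfies x = c y over the integers, while x < c.\<close>

lemma index_cong_neg:
  assumes "index_cong d t (t - c)" "0 < c" "c < t" "c * m < t" "t \<le> c * Suc m"
  shows "[m = 1] (mod d)"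
proof (rule index_congD[OF assms(1), of "c * Suc m - t" "Suc m"])
  show eq: "c * Suc m - t + (t - c) * Suc m = m * t"
  proof -
    have "(t - c) * Suc m + c * Suc m = t * Suc m"
      using assms(3) by (simp flip: add_mult_distrib)
    moreover have "t * Suc m = t + m * t"
      by simp
    ultimately show ?thesis
      using assms(5) by linarith
  qed
  show "minimal_pair t (t - c) (c * Suc m - t) (Suc m)"
    unfolding minimal_pair_def
  proof (intro conjI allI impI)
    show "t dvd c * Suc m - t + (t - c) * Suc m"
      unfolding eq by simp
    fix x y
    assume x: "x \<le> c * Suc m - t" and y: "y \<le> Suc m" and dvd: "t dvd x + (t - c) * y"
    have "int x - int c * int y = int (x + (t - c) * y) - int t * int y"
      using assms(3) by (simp add: of_nat_diff left_diff_distrib)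
    then obtain v where v: "int x - int c * int y = int t * v"
      using dvd by (metis dvd_def dvd_diff dvd_triv_left int_dvd_int_iff)
    have xc: "x < c"
      using x assms(2,4) by simp
    show "x = 0 \<and> y = 0 \<or> x = c * Suc m - t \<and> y = Suc m"
    proof (cases "y = Suc m")
      case True
      have "int x = int c * int (Suc m) + int t * v"
        using v True by simp
      moreover have "c * Suc m < 2 * t" "x + t \<le> c * Suc m"
        using assms(3,4,5) x by auto
      then have "int (c * Suc m) < int (2 * t)" "int (x + t) \<le> int (c * Suc m)"
        by (simp_all only: of_nat_less_iff of_nat_le_iff)
      then have "int c * int (Suc m) < 2 * int t" "int x + int t \<le> int c * int (Suc m)"
        by (simp_all only: of_nat_mult of_nat_add of_nat_numeral)
      ultimately have "int t * v \<le> int t * (-1)" "int t * (-2) < int t * v"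
        by linarith+
      moreover have "0 < int t"
        using assms(3) by simp
      ultimately have "v \<le> -1" "-2 < v"
        by (simp_all only: mult_le_cancel_left_pos mult_less_cancel_left_pos)
      then have "v = -1"
        by simp
      then have "int x + int t = int (c * Suc m)"
        using \<open>int x = _\<close> by (simp add: distrib_left)
      then have "x + t = c * Suc m"
        by (metis of_nat_add of_nat_eq_iff)
      then show ?thesis
        using True by simp
    next
      case False
      then have "c * y \<le> c * m"
        using y by simp
      then have cy: "int c * int y < int t"
        using assms(4) by (metis le_less_trans of_nat_less_iff of_nat_mult)
      have "v = 0"
      proof (rule ccontr)
        assume "v \<noteq> 0"
        then have "int t * 1 \<le> int t * \<bar>v\<bar>"
          by (intro mult_left_mono) auto
        then have "int t \<le> \<bar>int t * v\<bar>"
          by (simp add: abs_mult)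
        moreover have "0 \<le> int c * int y"
          by simp
        then have "\<bar>int x - int c * int y\<bar> < int t"
          using cy xc assms(3) by linarith
        ultimately show False
          using v by simp
      qed
      then have "x = c * y"
        using v by (simp flip: of_nat_mult)
      then show ?thesis
        using xc by (cases y) auto
    qed
  qed simp
qed

text \<open>One step of the Euclidean algorithm: k terms a fall short of t by r. After m + 1 rounds
  the deficits add up to at least a for the first time, so one further a fits in and only r (m + 1)
  - a < r terms 1 are needed. The resulting atom has index m + 1.\<close>

lemma index_cong_pos:
  assumes "index_cong d t a" "t = k * a + r" "r < a" "r * m < a" "a \<le> r * Suc m"
  shows "d dvd m"
proof -
  have r: "0 < r"
    using assms by (cases r) auto
  have x: "r * Suc m - a < r"
    using assms(4,5) r by simp
  have eq: "r * Suc m - a + a * (Suc m * k + 1) = Suc m * t"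
    using assms(2,5) by (simp add: algebra_simps)
  have "[Suc m = 1] (mod d)"
  proof (rule index_congD[OF assms(1) _ eq])
    show "minimal_pair t a (r * Suc m - a) (Suc m * k + 1)"
      unfolding minimal_pair_def
    proof (intro conjI allI impI)
      show "t dvd r * Suc m - a + a * (Suc m * k + 1)"
        unfolding eq by simp
      fix x' y'
      assume le: "x' \<le> r * Suc m - a" "y' \<le> Suc m * k + 1" and "t dvd x' + a * y'"
      then obtain z where z: "x' + a * y' = z * t"
        by (metis dvd_def mult.commute)
      have "a * y' \<le> a * (Suc m * k + 1)"
        using le(2) by (rule mult_le_mono2)
      then have "z * t \<le> Suc m * t"
        using le(1) z eq by linarith
      moreover have "0 < t"
        using assms(2) r by simp
      ultimately have "z \<le> Suc m"
        using mult_le_cancel2 by blast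
      consider "z = 0" | "z = Suc m" | "0 < z" "z \<le> m"
        using \<open>z \<le> Suc m\<close> by linarith
      then show "x' = 0 \<and> y' = 0 \<or> x' = r * Suc m - a \<and> y' = Suc m * k + 1"
      proof cases
        case 1
        then show ?thesis using z assms(3) by auto
      next
        case 2
        then have "x' = r * Suc m - a" "a * y' = a * (Suc m * k + 1)"
          using z[unfolded 2] eq le(1) \<open>a * y' \<le> _\<close> by linarith+
        moreover from this(2) have "y' = Suc m * k + 1"
          using assms(3) by (metis mult_cancel_left not_less0)
        ultimately show ?thesis by blast
      next
        \<comment> \<open>With at most z k terms a there are too few terms 1 to fill the deficit z
          r; with more of them the total is too large, because z r < a.\<close>
        case 3
        have "r \<le> z * r" "z * r \<le> m * r"
          using 3 by simp_all
        moreover have "m * r < a"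
          using assms(4) by (simp add: mult.commute)
        ultimately have zr: "x' < z * r" "z * r < a + x'"
          using x le(1) by linarith+
        have e: "x' + a * y' = z * r + a * (z * k)"
          using z assms(2) by (simp add: algebra_simps)
        show ?thesis
        proof (cases "y' \<le> z * k")
          case True
          then have "a * y' \<le> a * (z * k)"
            by (rule mult_le_mono2)
          then show ?thesis using e zr(1) by linarith
        next
          case False
          then have "a * (z * k + 1) \<le> a * y'"
            by (intro mult_le_mono2) simp
          then show ?thesis using e zr(2) by simp
        qed
      qed
    qed simp
  qed
  then show ?thesis
    by (simp add: cong_1_nat_iff)
qed

text \<open>Write t - 1 = c m + s with s < c. The two atoms at hand show that d divides m - 1 and t
  - c - 1 = c (m - 1) + s, hence s. Since c d + c \<le> c m < 5 d, one has s < c \<le> 4 \<le> d, so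
  s = 0.\<close>

lemma index_cong_small_neg:
  assumes "index_cong d t (t - c)" "coprime (t - c) t" "0 < c" "2 * c < t" "t \<le> 5 * d" "4 \<le> d"
  shows "c \<le> 4 \<and> c * d dvd t - c - 1"
proof -
  define m where "m = (t - 1) div c"
  define s where "s = (t - 1) mod c"
  have ms: "t - 1 = c * m + s" "s < c"
    using assms(3) by (simp_all add: m_def s_def)
  have "[m = 1] (mod d)"
    using index_cong_neg[OF assms(1,3), of m] ms assms(4) by simp
  moreover have m: "2 \<le> m"
    using assms(3,4) unfolding m_def by (simp add: less_eq_div_iff_mult_less_eq)
  ultimately have dvd: "d dvd m - 1"
    by (simp add: cong_1_nat_iff)
  then have "d \<le> m - 1"
    using m by (intro dvd_imp_le) auto
  then have "c * d \<le> c * (m - 1)"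
    by simp
  moreover have cm: "c * m = c * (m - 1) + c"
    using m by (cases m) auto
  ultimately have "c * d + c < 5 * d"
    using ms assms(4,5) by linarith
  then have c: "c \<le> 4"
    using mult_le_mono1[of 5 c d] by linarith
  have "[t - c = 1] (mod d)"
    using index_cong_self[OF assms(1,2)] assms(4) by simp
  then have "d dvd t - c - 1"
    using assms(4) by (simp add: cong_1_nat_iff)
  moreover have tc: "t - c - 1 = c * (m - 1) + s"
    using ms cm by linarith
  ultimately have "d dvd s"
    using dvd by (metis dvd_add_right_iff dvd_mult)
  then have "s = 0"
    using ms(2) c assms(6) by (auto dest: dvd_imp_le)
  then show ?thesis
    using c dvd tc by simp
qed

text \<open>The remainder r of t modulo a satisfies d r \<le> m r < a < t / 2 \<le> 5 d / 2, so r is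
  1 or 2. For r = 2 the congruence a = 1 modulo d forces a = 2 d + 1 and t = 2 a + 2.\<close>

lemma index_cong_small_pos:
  assumes "index_cong d t a" "coprime a t" "1 < a" "2 * a < t" "t \<le> 5 * d"
  shows "t = 4 * d + 4 \<or> (\<exists>k. t = k * a + 1)"
proof -
  define k where "k = t div a"
  define r where "r = t mod a"
  define m where "m = (a - 1) div r"
  have t: "t = k * a + r" "r < a"
    using assms(3) by (simp_all add: k_def r_def)
  have "r \<noteq> 0"
    using assms(2,3) unfolding r_def by (metis coprime_absorb_left mod_0_imp_dvd nat_dvd_1_iff_1 nat_neq_iff)
  have "a - 1 = r * m + (a - 1) mod r" "(a - 1) mod r < r"
    using \<open>r \<noteq> 0\<close> by (simp_all add: m_def)
  then have m: "r * m < a" "a \<le> r * Suc m"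
    using assms(3) by simp_all
  have "0 < m"
    using m(2) t(2) by (cases m) auto
  then have "d \<le> m"
    using index_cong_pos[OF assms(1) t m] by (simp add: dvd_imp_le)
  then have dr: "d * r < a"
    using m(1) by (metis le_less_trans mult.commute mult_le_mono2)
  then have "2 * (d * r) < 5 * d"
    using assms(4,5) by linarith
  then have "2 * r < 5"
    by (metis mult.left_commute mult.commute nat_mult_less_cancel_disj)
  then consider "r = 1" | "r = 2"
    using \<open>r \<noteq> 0\<close> by linarith
  then show ?thesis
  proof cases
    case 1
    then show ?thesis using t by blast
  next
    case 2
    have "[a = 1] (mod d)"
      using index_cong_self[OF assms(1,2)] assms(4) by simp
    then obtain j where j: "a - 1 = d * j"
      using assms(3) by (auto simp: cong_1_nat_iff elim: dvdE)
    then have "a = d * j + 1"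
      using assms(3) by linarith
    then have "d * 2 \<le> d * j" "2 * (d * j) < 5 * d"
      using dr[unfolded 2] assms(4,5) by linarith+
    then have "2 \<le> j" "2 * j < 5"
      by (simp_all add: mult.left_commute[of 2])
    then have "j = 2"
      by linarith
    then have a: "a = 2 * d + 1"
      using j assms(3) by simp
    have "2 \<le> k"
    proof (rule ccontr)
      assume "\<not> 2 \<le> k"
      then have "k * a \<le> 1 * a"
        by (intro mult_le_mono1) simp
      then show False
        using t(1) assms(3,4) unfolding 2 by linarith
    qed
    have "k \<le> 2"
    proof (rule ccontr)
      assume "\<not> k \<le> 2"
      then have "3 * a \<le> k * a"
        by (intro mult_le_mono1) simp
      then show False
        using t 2 a assms(5) by simp
    qed
    show ?thesis
      using t a 2 \<open>2 \<le> k\<close> \<open>k \<le> 2\<close> by simp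
  qed
qed

text \<open>\<open>b\<close> expresses the first element of the pair by the second. This symmetry
  settles t = k a + 1: there -k is the inverse of a, so \<open>b\<close> is t - k with small k, and
  the estimate for -c applies to it.\<close>

lemma pair_classification:
  assumes "index_cong d t a" "index_cong d t b" "[a * b = 1] (mod t)"
    and "1 < a" "a < t" "b < t" "t \<le> 5 * d" "4 \<le> d"
  shows "t = 4 * d + 4 \<or>
    (\<exists>c. 0 < c \<and> 2 * c < t \<and> c \<le> 4 \<and> (a = t - c \<or> b = t - c) \<and> c * d dvd t - c - 1)"
proof -
  have cop: "coprime a t" "coprime b t"
    using assms(3) by (metis cong_imp_coprime cong_sym coprime_1_left coprime_mult_left_iff)+
  have "2 * a \<noteq> t"
    using cop(1) assms(4) by auto
  then consider "t < 2 * a" | "2 * a < t"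
    by linarith
  then show ?thesis
  proof cases
    case 1
    then show ?thesis
      using index_cong_small_neg[of d t "t - a"] assms cop by (intro disjI2 exI[of _ "t - a"]) auto
  next
    case 2
    from index_cong_small_pos[OF assms(1) cop(1) assms(4) 2 assms(7)]
    show ?thesis
    proof
      assume "\<exists>k. t = k * a + 1"
      then obtain k where k: "t = k * a + 1" ..
      have "k * 2 \<le> k * a"
        using assms(4) by (intro mult_le_mono2) simp
      then have k2: "2 * k < t"
        using k by linarith
      have k0: "0 < k"
        using k assms(4,5) by (cases k) auto
      have "a * (t - k) = (a - 1) * t + 1"
      proof -
        have "a * (t - k) + a * k = a * t"
          using k2 by (simp flip: add_mult_distrib2)
        moreover have "(a - 1) * t + t = a * t"
          using assms(4) by (cases a) auto
        ultimately show ?thesis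
          using k by (simp add: mult.commute)
      qed
      then have "[a * (t - k) = 1] (mod t)"
        unfolding cong_def by (simp only: mod_mult_self3)
      then have "[a * b = a * (t - k)] (mod t)"
        using assms(3) cong_sym cong_trans by blast
      then have "[b = t - k] (mod t)"
        using cop(1) by (simp add: cong_mult_lcancel_nat)
      then have "b = t - k"
        using assms(6) k0 k2 by (simp add: cong_def)
      then show ?thesis
        using index_cong_small_neg[of d t k] assms cop k0 k2 by (intro disjI2 exI[of _ k]) auto
    qed simp
  qed
qed

section \<open>Zero-sum sequences in terms of weights\<close>

lemma replicate_mset_add: "replicate_mset (m + k) y = replicate_mset m y + replicate_mset k y"
  by (induction m) auto

text \<open>
  The weight of \<open>g\<close> is its discrete logarithm with respect to some generator. It is
  normalised to \<open>{1..n}\<close>, so that the neutral element has weight \<open>n\<close> and not \<open>0\<close>: then every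
  sequence of total weight \<open>n\<close> is an atom.
\<close>

locale weighting =
  fixes Z :: "'a multiset set" and X :: "'a set" and n :: nat and x :: "'a \<Rightarrow> nat"
  assumes Z_eq: "Z = {S. set_mset S \<subseteq> X \<and> n dvd (\<Sum>g\<in>#S. x g)}"
    and n_pos: "0 < n"
    and x_pos: "\<And>g. g \<in> X \<Longrightarrow> 0 < x g"
    and x_le: "\<And>g. g \<in> X \<Longrightarrow> x g \<le> n"
    and x_inj: "inj_on x X"
begin

abbreviation wt :: "'a multiset \<Rightarrow> nat" where
  "wt S \<equiv> (\<Sum>g\<in>#S. x g)"

lemma wt_pos:
  assumes "set_mset S \<subseteq> X" "S \<noteq> {#}"
  shows "0 < wt S"
  using assms x_pos by (cases S) auto

lemma atomsI:
  assumes "set_mset S \<subseteq> X" "n dvd wt S" "S \<noteq> {#}"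
    and "\<And>T. T \<subseteq># S \<Longrightarrow> n dvd wt T \<Longrightarrow> T = {#} \<or> T = S"
  shows "S \<in> atoms Z"
  using assms unfolding atoms_def Z_eq by (auto simp: subset_mset.less_le)

lemma atomsD:
  assumes "S \<in> atoms Z"
  shows "set_mset S \<subseteq> X" "n dvd wt S" "S \<noteq> {#}"
    "\<And>T. T \<subseteq># S \<Longrightarrow> n dvd wt T \<Longrightarrow> T = {#} \<or> T = S"
proof -
  show *: "set_mset S \<subseteq> X" "n dvd wt S" "S \<noteq> {#}"
    using assms by (auto simp: atoms_def Z_eq)
  fix T
  assume T: "T \<subseteq># S" "n dvd wt T"
  then have "set_mset T \<subseteq> X"
    using *(1) set_mset_mono by blast
  then have "T \<in> Z"
    using T by (simp add: Z_eq)
  then show "T = {#} \<or> T = S"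
    using assms T(1) unfolding atoms_def by (auto simp: subset_mset.less_le)
qed

lemma atom_of_wt_eq:
  assumes "set_mset S \<subseteq> X" "wt S = n"
  shows "S \<in> atoms Z"
proof (rule atomsI)
  show "S \<noteq> {#}" using assms n_pos by auto
  fix T
  assume T: "T \<subseteq># S" "n dvd wt T"
  then obtain R where R: "S = T + R"
    by (metis subset_mset.le_iff_add)
  show "T = {#} \<or> T = S"
  proof (rule ccontr)
    assume "\<not> ?thesis"
    then have "T \<noteq> {#}" "R \<noteq> {#}"
      using R by auto
    then have "0 < wt T" "0 < wt R"
      using R assms(1) by (auto intro!: wt_pos)
    then have "wt T < n" "0 < wt T"
      using R assms(2) by auto
    then show False
      using T(2) nat_dvd_not_less by blast
  qed
qed (use assms in auto)

lemma ex_factorization: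
  assumes "set_mset S \<subseteq> X" "n dvd wt S"
  shows "\<exists>F. set_mset F \<subseteq> atoms Z \<and> \<Sum>\<^sub># F = S"
  using assms
proof (induction "size S" arbitrary: S rule: less_induct)
  case less
  show ?case
  proof (cases "S = {#} \<or> S \<in> atoms Z")
    case True
    then show ?thesis
    proof
      assume "S = {#}"
      then show ?thesis by (intro exI[of _ "{#}"]) auto
    next
      assume "S \<in> atoms Z"
      then show ?thesis by (intro exI[of _ "{#S#}"]) auto
    qed
  next
    case False
    then obtain T where T: "T \<subseteq># S" "n dvd wt T" "T \<noteq> {#}" "T \<noteq> S"
      using less.prems atomsI[of S] by blast
    then obtain R where R: "S = T + R"
      by (metis subset_mset.le_iff_add)
    have "n dvd wt R"
      using less.prems(2) T(2) R by (simp add: dvd_add_right_iff)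
    moreover have "R \<noteq> {#}"
      using R T(4) by auto
    ultimately obtain F F' where "set_mset F \<subseteq> atoms Z" "\<Sum>\<^sub># F = T"
        "set_mset F' \<subseteq> atoms Z" "\<Sum>\<^sub># F' = R"
      using less.hyps[of T] less.hyps[of R] less.prems(1) T R
      by (auto simp: nonempty_has_size)
    then show ?thesis
      using R by (intro exI[of _ "F + F'"]) auto
  qed
qed

text \<open>The index is additive. If it is 1 modulo d on atoms, the length of a factorization is
  congruent to the index of the product, which does not depend on the factorization.\<close>

lemma lengths_congI:
  assumes "\<And>A. A \<in> atoms Z \<Longrightarrow> [wt A div n = 1] (mod d)"
  shows "lengths_cong d Z"
proof -
  have "n dvd wt (\<Sum>\<^sub># F) \<and> [wt (\<Sum>\<^sub># F) div n = size F] (mod d)" if "set_mset F \<subseteq> atoms Z" for F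
    using that
  proof (induction F)
    case (add A F)
    then have "n dvd wt A" "n dvd wt (\<Sum>\<^sub># F)" "[wt A div n = 1] (mod d)"
        "[wt (\<Sum>\<^sub># F) div n = size F] (mod d)"
      using assms atomsD(2) by auto
    then show ?case
      using cong_add[of "wt A div n" 1 d "wt (\<Sum>\<^sub># F) div n" "size F"] by simp
  qed simp
  then show ?thesis
    unfolding lengths_cong_def by (metis cong_sym cong_trans)
qed

text \<open>
  Compare \<open>\<Prod> (e\<^bsup>n - x g\<^esup> g)\<close>, taken over all terms \<open>g\<close> of \<open>A\<close>, with \<open>A\<close> times a power
  of the atom \<open>e\<^bsup>n\<^esup>\<close>.
\<close>

lemma atom_wt_cong:
  assumes "lengths_cong d Z" "e \<in> X" "x e = 1" "A \<in> atoms Z"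
  shows "[wt A div n = 1] (mod d)"
proof -
  define U where "U = (\<lambda>g. add_mset g (replicate_mset (n - x g) e))"
  define z where "z = wt A div n"
  have A: "set_mset A \<subseteq> X" "n dvd wt A" "A \<noteq> {#}"
    using atomsD[OF assms(4)] by auto
  have zn: "wt A = z * n"
    using A(2) by (simp add: z_def)
  have U: "U g \<in> atoms Z" if "g \<in> X" for g
    using that assms(2,3) x_le[of g] by (intro atom_of_wt_eq) (auto simp: U_def)
  have E: "replicate_mset n e \<in> atoms Z"
    using assms(2,3) by (intro atom_of_wt_eq) auto
  have sum: "\<Sum>\<^sub># (image_mset U S) = S + replicate_mset (n * size S - wt S) e \<and> wt S \<le> n * size S"
    if "set_mset S \<subseteq> X" for S
    using that
  proof (induction S)
    case (add g S)
    then have "x g \<le> n" "wt S \<le> n * size S"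
      using x_le by auto
    then have "n - x g + (n * size S - wt S) = n * Suc (size S) - (x g + wt S)"
      by simp
    then have "replicate_mset (n - x g) e + replicate_mset (n * size S - wt S) e =
        replicate_mset (n * Suc (size S) - (x g + wt S)) e"
      by (metis replicate_mset_add)
    then show ?case
      using add \<open>x g \<le> n\<close> by (simp add: U_def)
  qed simp
  have le: "z \<le> size A"
    using sum[OF A(1)] zn n_pos by (simp add: mult.commute)
  define F where "F = add_mset A (replicate_mset (size A - z) (replicate_mset n e))"
  have "\<Sum>\<^sub># (replicate_mset m (replicate_mset n e)) = replicate_mset (m * n) e" for m
    by (induction m) (simp_all add: replicate_mset_add)
  moreover have "n * size A - wt A = (size A - z) * n"
    using zn by (simp add: diff_mult_distrib mult.commute[of n])
  ultimately have "\<Sum>\<^sub># (image_mset U A) = \<Sum>\<^sub># F"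
    using sum[OF A(1)] by (simp add: F_def)
  then have "[size F = size (image_mset U A)] (mod d)"
    using assms(1,4) A U E by (intro lengths_congD[of _ Z]) (auto simp: F_def)
  then have "[Suc (size A - z) = size A] (mod d)"
    by (simp add: F_def)
  then have "[Suc (size A - z) + z = size A + z] (mod d)"
    by (rule cong_add_rcancel_nat[THEN iffD2])
  then have "[size A + 1 = size A + z] (mod d)"
    using le by simp
  then show ?thesis
    unfolding z_def[symmetric] by (metis cong_add_lcancel_nat cong_sym)
qed

text \<open>
  Passing from \<open>(g, h)\<close> to \<open>(\<alpha> g, \<beta> h)\<close> does not change the zero-sum sequences; in the
  group generated by \<open>\<alpha> g\<close>, which has order \<open>t\<close>, the second element is \<open>a\<close> times the first.
\<close>

lemma index_cong_pair:
  assumes "lengths_cong d Z" "g \<in> X" "h \<in> X" "g \<noteq> h" "0 < \<alpha>" "0 < \<beta>" "0 < a" "a < t"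
    and zs: "\<And>i j. n dvd i * x g + j * x h \<longleftrightarrow>
               (\<exists>i' j'. i = \<alpha> * i' \<and> j = \<beta> * j' \<and> t dvd i' + a * j')"
  shows "index_cong d t a"
proof -
  define M where "M = (\<lambda>i j. replicate_mset (\<alpha> * i) g + replicate_mset (\<beta> * j) h)"
  have M_add: "M i j + M i' j' = M (i + i') (j + j')" for i j i' j'
    by (simp add: M_def add_mult_distrib2 replicate_mset_add)
  have M_sum: "\<Sum>\<^sub># (replicate_mset m (M i j)) = M (m * i) (m * j)" for m i j
    by (induction m) (simp_all add: M_add, simp add: M_def)
  have M_atom: "M i j \<in> atoms Z" if "minimal_pair t a i j" for i j
  proof (rule atomsI)
    have "n dvd \<alpha> * i * x g + \<beta> * j * x h"
      using zs that unfolding minimal_pair_def by blast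
    then show "n dvd wt (M i j)"
      by (simp add: M_def)
    show "M i j \<noteq> {#}"
      using that assms(5,6) by (auto simp: M_def minimal_pair_def)
    show "set_mset (M i j) \<subseteq> X"
      using assms(2,3) by (auto simp: M_def split: if_splits)
    fix T
    assume T: "T \<subseteq># M i j" "n dvd wt T"
    have T_eq: "T = replicate_mset (count T g) g + replicate_mset (count T h) h"
    proof (rule multiset_eqI)
      fix y
      have "count T y \<le> count (M i j) y"
        using T(1) by (rule mset_subset_eq_count)
      then show "count T y = count (replicate_mset (count T g) g + replicate_mset (count T h) h) y"
        using assms(4) by (auto simp: M_def split: if_splits)
    qed
    have "wt T = count T g * x g + count T h * x h"
      by (subst T_eq) simp
    then have "n dvd count T g * x g + count T h * x h"
      using T(2) by simp
    then obtain i' j' where ij: "count T g = \<alpha> * i'" "count T h = \<beta> * j'" "t dvd i' + a * j'"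
      unfolding zs by blast
    have "count T g \<le> count (M i j) g" "count T h \<le> count (M i j) h"
      by (rule mset_subset_eq_count[OF T(1)])+
    then have "i' \<le> i" "j' \<le> j"
      using assms(4,5,6) ij by (auto simp: M_def)
    then have "i' = 0 \<and> j' = 0 \<or> i' = i \<and> j' = j"
      using that ij(3) unfolding minimal_pair_def by blast
    then show "T = {#} \<or> T = M i j"
      using T_eq[unfolded ij(1,2)] by (auto simp: M_def)
  qed
  have "minimal_pair t a t 0"
    using assms(8) unfolding minimal_pair_def by (auto dest: dvd_imp_le)
  then have E: "M t 0 \<in> atoms Z"
    by (rule M_atom)
  have "minimal_pair t a (t - a) 1"
    unfolding minimal_pair_def
  proof (intro conjI allI impI)
    fix i j
    assume le: "i \<le> t - a" "j \<le> 1" and dvd: "t dvd i + a * j"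
    show "i = 0 \<and> j = 0 \<or> i = t - a \<and> j = 1"
    proof (cases "j = 0")
      case True
      then have "i = 0"
        using dvd le(1) assms(7,8) by (auto dest: dvd_imp_le)
      then show ?thesis using True by simp
    next
      case False
      then have "j = 1" using le(2) by simp
      then have "t \<le> i + a"
        using dvd assms(7) by (auto dest: dvd_imp_le)
      then show ?thesis
        using le(1) \<open>j = 1\<close> by simp
    qed
  qed (use assms(8) in auto)
  then have V: "M (t - a) 1 \<in> atoms Z"
    by (rule M_atom)
  have "[z = 1] (mod d)" if mp: "minimal_pair t a i j" and z: "i + a * j = z * t" for i j z
  proof (cases "z \<le> j")
    case True
    \<comment> \<open>The j-th power of the atom (t - a, 1) equals (i, j) times j - z copies of the
      atom (t, 0); the lengths j and j - z + 1 are compared.\<close>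
    define F where "F = add_mset (M i j) (replicate_mset (j - z) (M t 0))"
    have "j * (t - a) + (j * a + z * t) = j * t + z * t"
      using assms(8) by (simp add: diff_mult_distrib2)
    moreover have "(j - z) * t + z * t = j * t"
      using True by (simp flip: add_mult_distrib)
    ultimately have "j * (t - a) = i + (j - z) * t"
      using z by (simp add: mult.commute)
    then have "\<Sum>\<^sub># F = \<Sum>\<^sub># (replicate_mset j (M (t - a) 1))"
      by (simp add: F_def M_sum M_add)
    then have "[size F = size (replicate_mset j (M (t - a) 1))] (mod d)"
      using V E M_atom[OF mp] assms(1)
      by (intro lengths_congD[of _ Z]) (auto simp: F_def split: if_splits)
    then have "[Suc (j - z) = j] (mod d)"
      by (simp add: F_def)
    then have "[Suc (j - z) + z = j + z] (mod d)"
      by (rule cong_add_rcancel_nat[THEN iffD2])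
    then have "[j + 1 = j + z] (mod d)"
      using True by simp
    then show ?thesis
      by (metis cong_add_lcancel_nat cong_sym)
  next
    case False
    \<comment> \<open>For z > j only the atom (t, 0) is left: i \<le> t and i + a j = z t \<ge> (j +
      1) t with a < t give j = 0.\<close>
    have "i \<le> t"
    proof (rule ccontr)
      assume "\<not> i \<le> t"
      then have "t \<le> i" "t \<noteq> i" by auto
      then show False
        using mp assms(8) unfolding minimal_pair_def by (metis add.right_neutral dvd_refl le0 mult_0_right not_less0)
    qed
    have "(j + 1) * t \<le> z * t"
      using False by (intro mult_le_mono1) simp
    then have "j * t \<le> a * j"
      using z \<open>i \<le> t\<close> unfolding add_mult_distrib by linarith
    then have "j = 0"
      using assms(8) by (metis leD mult.commute mult_less_mono2 gr0I)
    then have "i = z * t" "0 < z"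
      using z False by auto
    then have "z * t \<le> 1 * t"
      using \<open>i \<le> t\<close> by simp
    then have "z = 1"
      using \<open>0 < z\<close> assms(8) unfolding mult_le_cancel2 by simp
    then show ?thesis by simp
  qed
  then show ?thesis
    unfolding index_cong_def by blast
qed

end

section \<open>Compatible weights\<close>

definition ord_of :: "nat \<Rightarrow> nat \<Rightarrow> nat" where
  "ord_of n k = n div gcd k n"

text \<open>k = w u with w = gcd k n and u prime to the order n / w of k. Given w, the class of u
  modulo n / w determines that of k modulo n.\<close>

definition unit_of :: "nat \<Rightarrow> nat \<Rightarrow> nat" where
  "unit_of n k = k div gcd k n"

text \<open>
  Pairwise compatible weights have the form \<open>w u\<close> with divisors \<open>w\<close> of \<open>n\<close> and a common factor
  \<open>u\<close>.
\<close>

definition compatible :: "nat \<Rightarrow> nat \<Rightarrow> nat \<Rightarrow> bool" where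
  "compatible n k l \<longleftrightarrow> [unit_of n k = unit_of n l] (mod gcd (ord_of n k) (ord_of n l))"

lemma ord_of_mult: "gcd k n * ord_of n k = n"
  by (simp add: ord_of_def)

lemma unit_of_mult: "gcd k n * unit_of n k = k"
  by (simp add: unit_of_def)

lemma coprime_unit_of: "0 < n \<Longrightarrow> coprime (unit_of n k) (ord_of n k)"
  unfolding unit_of_def ord_of_def by (intro div_gcd_coprime) simp

lemma ord_of_pos: "0 < n \<Longrightarrow> 0 < ord_of n k"
  using ord_of_mult[of k n] by (intro gr0I) auto

lemma dvd_mult_iff_ord_of: "0 < n \<Longrightarrow> n dvd j * k \<longleftrightarrow> ord_of n k dvd j"
proof -
  assume n: "0 < n"
  have "n dvd j * k \<longleftrightarrow> gcd k n * ord_of n k dvd gcd k n * (j * unit_of n k)"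
    by (simp only: ord_of_mult mult.left_commute[of "gcd k n" j] unit_of_mult)
  also have "\<dots> \<longleftrightarrow> ord_of n k dvd j * unit_of n k"
    using n by simp
  also have "\<dots> \<longleftrightarrow> ord_of n k dvd j"
    using coprime_unit_of[OF n, of k] by (simp add: coprime_commute coprime_dvd_mult_left_iff)
  finally show ?thesis .
qed

text \<open>A relation i k + j l = 0 places i k in the intersection of the two cyclic subgroups,
  which has order t; so i and j are multiples of ord k / t and ord l / t. These multiples turn k and
  l into q u and q u' with the same q = n / t and the unit parts u, u', and a is u' / u modulo
  t.\<close>

lemma zero_sum_pair_iff:
  assumes n: "0 < n" and t: "t = gcd (ord_of n k) (ord_of n l)"
    and a: "[unit_of n k * a = unit_of n l] (mod t)"
  shows "n dvd i * k + j * l \<longleftrightarrow>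
    (\<exists>i' j'. i = (ord_of n k div t) * i' \<and> j = (ord_of n l div t) * j' \<and> t dvd i' + a * j')"
proof -
  define \<alpha> where "\<alpha> = ord_of n k div t"
  define \<beta> where "\<beta> = ord_of n l div t"
  have t0: "0 < t"
    using ord_of_pos[OF n] by (simp add: t)
  have \<alpha>: "ord_of n k = t * \<alpha>" and \<beta>: "ord_of n l = t * \<beta>"
    by (simp_all add: \<alpha>_def \<beta>_def t)
  have cop: "coprime \<alpha> \<beta>"
    unfolding \<alpha>_def \<beta>_def t using ord_of_pos[OF n, of k] by (intro div_gcd_coprime) simp
  have cu: "coprime (unit_of n k) t"
    using coprime_unit_of[OF n, of k] by (simp add: \<alpha>)
  have nk: "n = gcd k n * \<alpha> * t" and nl: "n = gcd l n * \<beta> * t"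
    using ord_of_mult[of k n] ord_of_mult[of l n] unfolding \<alpha> \<beta> by (simp_all add: ac_simps)
  define q where "q = gcd k n * \<alpha>"
  have q: "q = gcd k n * \<alpha>" "q = gcd l n * \<beta>" "n = q * t"
    using nk nl t0 unfolding q_def by (simp, metis mult_cancel_right less_irrefl, simp)
  have key: "n dvd \<alpha> * i' * k + \<beta> * j' * l \<longleftrightarrow> t dvd i' + a * j'" for i' j'
  proof -
    have "\<alpha> * i' * k = q * (unit_of n k * i')"
      by (subst unit_of_mult[of k n, symmetric]) (simp add: q(1) ac_simps)
    moreover have "\<beta> * j' * l = q * (unit_of n l * j')"
      by (subst unit_of_mult[of l n, symmetric]) (simp add: q(2) ac_simps)
    ultimately have "\<alpha> * i' * k + \<beta> * j' * l = q * (unit_of n k * i' + unit_of n l * j')"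
      by (simp only: distrib_left)
    then have "n dvd \<alpha> * i' * k + \<beta> * j' * l \<longleftrightarrow> t dvd unit_of n k * i' + unit_of n l * j'"
      using n q(3) by simp
    also have "[unit_of n k * i' + unit_of n l * j' = unit_of n k * i' + unit_of n k * a * j'] (mod t)"
      using a by (intro cong_add cong_mult) (auto simp: cong_sym_eq)
    then have "t dvd unit_of n k * i' + unit_of n l * j' \<longleftrightarrow> t dvd unit_of n k * (i' + a * j')"
      by (simp add: cong_dvd_iff distrib_left mult.assoc)
    also have "\<dots> \<longleftrightarrow> t dvd i' + a * j'"
      using cu by (simp add: coprime_commute coprime_dvd_mult_right_iff)
    finally show ?thesis .
  qed
  have "\<alpha> dvd i \<and> \<beta> dvd j" if "n dvd i * k + j * l"
  proof
    \<comment> \<open>Multiplying the relation by the order of one weight removes that weight;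
      coprimality of \<alpha> and \<beta> then gives the divisibility.\<close>
    have "n dvd ord_of n l * (j * l)" "n dvd ord_of n k * (i * k)"
      using dvd_mult_iff_ord_of[OF n, of "ord_of n l * j" l] dvd_mult_iff_ord_of[OF n, of "ord_of n k * i" k]
      by (simp_all add: mult.assoc)
    moreover have "n dvd ord_of n l * (i * k + j * l)" "n dvd ord_of n k * (i * k + j * l)"
      using that by simp_all
    ultimately have "n dvd (ord_of n l * i) * k" "n dvd (ord_of n k * j) * l"
      by (simp_all add: distrib_left dvd_add_left_iff dvd_add_right_iff mult.assoc)
    then have "t * \<alpha> dvd t * (\<beta> * i)" "t * \<beta> dvd t * (\<alpha> * j)"
      unfolding dvd_mult_iff_ord_of[OF n] by (simp_all add: \<alpha> \<beta> mult.assoc)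
    then have "\<alpha> dvd \<beta> * i" "\<beta> dvd \<alpha> * j"
      using t0 by simp_all
    then show "\<alpha> dvd i" "\<beta> dvd j"
      using cop by (simp_all add: coprime_commute coprime_dvd_mult_right_iff)
  qed
  then show ?thesis
    unfolding \<alpha>_def[symmetric] \<beta>_def[symmetric]
  proof (intro iffI)
    assume L: "n dvd i * k + j * l"
    then obtain i' j' where "i = \<alpha> * i'" "j = \<beta> * j'"
      using \<open>n dvd i * k + j * l \<Longrightarrow> \<alpha> dvd i \<and> \<beta> dvd j\<close> by (auto elim!: dvdE)
    then show "\<exists>i' j'. i = \<alpha> * i' \<and> j = \<beta> * j' \<and> t dvd i' + a * j'"
      using L key[of i' j'] by blast
  qed (use key in blast)
qed

lemma cong_imp_eq_nat:
  fixes k l r :: nat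
  assumes "[k = l] (mod r)" "0 < k" "k \<le> r" "0 < l" "l \<le> r"
  shows "k = l"
proof -
  have "i = j" if "[i = j] (mod r)" "0 < j" "j \<le> i" "i \<le> r" for i j
  proof -
    have "r dvd i - j" "i - j < r"
      using that by (auto simp: cong_altdef_nat)
    then show "i = j"
      using that(3) by (cases "i - j = 0") (auto dest: dvd_imp_le)
  qed
  then show ?thesis
    using assms cong_sym[OF assms(1)] by (cases "k \<le> l") auto
qed

text \<open>Instead of a global common factor, a local one is used. Choose \<open>g0\<close> so that
  its order has the largest p-part, and let u be its unit part. Compatibility with \<open>g0\<close>
  gives x g = u w modulo the p-part of n for every g in A with gcd w, and u is prime to p as soon as
  p divides the order of \<open>g0\<close>. Otherwise the p-part of n divides every w.\<close>

lemma prime_power_dvd_sum_gcd: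
  fixes p n :: nat
  assumes p: "prime p" and n: "0 < n" and "A \<noteq> {#}" and dvd: "n dvd (\<Sum>g\<in>#A. x g)"
    and compat: "\<And>g h. g \<in># A \<Longrightarrow> h \<in># A \<Longrightarrow> compatible n (x g) (x h)"
  shows "p ^ multiplicity p n dvd (\<Sum>g\<in>#A. gcd (x g) n)"
proof -
  define P where "P = p ^ multiplicity p n"
  define w where "w g = gcd (x g) n" for g
  define r where "r g = ord_of n (x g)" for g
  define u where "u g = unit_of n (x g)" for g
  have w0: "w g \<noteq> 0" and r0: "r g \<noteq> 0" for g
    using n ord_of_pos[OF n, of "x g"] by (simp_all add: w_def r_def)
  have wr: "w g * r g = n" and wu: "w g * u g = x g" for g
    by (simp_all add: w_def r_def u_def ord_of_mult unit_of_mult)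
  have mult: "multiplicity p n = multiplicity p (w g) + multiplicity p (r g)" for g
    using p w0 r0 by (subst wr[of g, symmetric]) (simp add: prime_elem_multiplicity_mult_distrib)
  obtain g0 where g0: "g0 \<in># A" "\<And>g. g \<in># A \<Longrightarrow> multiplicity p (w g0) \<le> multiplicity p (w g)"
    using ex_is_arg_min_if_finite[of "set_mset A" "\<lambda>g. multiplicity p (w g)"] assms(3)
    by (auto simp: is_arg_min_linorder)
  show ?thesis
  proof (cases "p dvd r g0")
    case False
    then have "multiplicity p (r g0) = 0"
      by (simp add: not_dvd_imp_multiplicity_0)
    then have "multiplicity p n \<le> multiplicity p (w g)" if "g \<in># A" for g
      using g0(2)[OF that] mult[of g0] by simp
    then have "p ^ multiplicity p n dvd w g" if "g \<in># A" for g
      using that by (simp add: multiplicity_dvd')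
    then show ?thesis
      unfolding w_def[symmetric] by (induction A) auto
  next
    case True
    have P: "[x g = u g0 * w g] (mod P)" if "g \<in># A" for g
    proof -
      have "multiplicity p (r g) \<le> multiplicity p (r g0)"
        using g0(2)[OF that] mult[of g] mult[of g0] by simp
      then have "p ^ multiplicity p (r g) dvd gcd (r g) (r g0)"
        by (simp add: multiplicity_dvd multiplicity_dvd')
      then have "P dvd w g * gcd (r g) (r g0)"
        unfolding P_def mult[of g] power_add by (intro mult_dvd_mono multiplicity_dvd)
      moreover have "[u g = u g0] (mod gcd (r g) (r g0))"
        using compat[OF that g0(1)] by (simp add: compatible_def u_def r_def)
      then have "[w g * u g = w g * u g0] (mod w g * gcd (r g) (r g0))"
        using w0 by (simp add: cong_def mod_mult_mult1)
      ultimately have "[w g * u g = w g * u g0] (mod P)"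
        using cong_dvd_modulus_nat by blast
      then show ?thesis
        unfolding wu by (simp add: mult.commute)
    qed
    have "[(\<Sum>g\<in>#B. x g) = u g0 * (\<Sum>g\<in>#B. w g)] (mod P)" if "set_mset B \<subseteq> set_mset A" for B
      using that
    proof (induction B)
      case (add g B)
      then show ?case
        using cong_add[OF P[of g]] by (simp add: distrib_left)
    qed simp
    then have "[(\<Sum>g\<in>#A. x g) = u g0 * (\<Sum>g\<in>#A. w g)] (mod P)"
      by simp
    moreover have "P dvd (\<Sum>g\<in>#A. x g)"
      using dvd multiplicity_dvd[of p n] unfolding P_def by (rule dvd_trans[rotated])
    ultimately have "P dvd u g0 * (\<Sum>g\<in>#A. w g)"
      by (simp add: cong_dvd_iff)
    moreover have "coprime (u g0) p"
      using True coprime_unit_of[OF n, of "x g0"] coprime_divisors[OF dvd_refl, of p "r g0" "u g0"]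
      unfolding u_def r_def by blast
    then have "coprime P (u g0)"
      by (simp add: P_def coprime_commute)
    ultimately show ?thesis
      unfolding P_def[symmetric] w_def[symmetric] by (simp add: coprime_dvd_mult_right_iff)
  qed
qed

lemma dvd_sum_gcd:
  fixes n :: nat
  assumes "0 < n" "n dvd (\<Sum>g\<in>#A. x g)"
    and "\<And>g h. g \<in># A \<Longrightarrow> h \<in># A \<Longrightarrow> compatible n (x g) (x h)"
  shows "n dvd (\<Sum>g\<in>#A. gcd (x g) n)"
proof (cases "A = {#}")
  case False
  then have "(\<Sum>g\<in>#A. gcd (x g) n) \<noteq> 0"
    using assms(1) by auto
  show ?thesis
  proof (rule multiplicity_le_imp_dvd)
    show "n \<noteq> 0"
      using assms(1) by simp
    fix p :: nat
    assume p: "prime p"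
    show "multiplicity p n \<le> multiplicity p (\<Sum>g\<in>#A. gcd (x g) n)"
    proof (rule multiplicity_geI)
      show "p ^ multiplicity p n dvd (\<Sum>g\<in>#A. gcd (x g) n)"
        by (rule prime_power_dvd_sum_gcd[OF p assms(1) False assms(2,3)])
    qed (use p \<open>(\<Sum>g\<in>#A. gcd (x g) n) \<noteq> 0\<close> in \<open>auto dest: prime_gt_Suc_0_nat\<close>)
  qed
qed simp

text \<open>The divisors n / j with j \<ge> 6 are at most n / 6, and there are at most five others.
  From 150 on, n / 5 - n / 6 = n / 30 is at least 5.\<close>

lemma card_divisors_le:
  fixes n d :: nat
  assumes "n \<le> 5 * d" "150 \<le> n"
  shows "card {k. k dvd n} \<le> d"
proof -
  have "{k. k dvd n} \<subseteq> {1..n div 6} \<union> (\<lambda>j. n div j) ` {1..5}"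
  proof
    fix k
    assume "k \<in> {k. k dvd n}"
    then obtain j where j: "n = k * j"
      by auto
    then have "0 < k" "0 < j"
      using assms(2) by (auto intro: gr0I)
    show "k \<in> {1..n div 6} \<union> (\<lambda>j. n div j) ` {1..5}"
    proof (cases "j \<le> 5")
      case True
      then show ?thesis
        using j \<open>0 < j\<close> by (intro UnI2 image_eqI[of _ _ j]) auto
    next
      case False
      then have "k * 6 \<le> k * j"
        by (intro mult_le_mono2) simp
      then show ?thesis
        using j \<open>0 < k\<close> by (simp add: less_eq_div_iff_mult_less_eq)
    qed
  qed
  then have "card {k. k dvd n} \<le> card ({1..n div 6} \<union> (\<lambda>j. n div j) ` {1..5})"
    by (intro card_mono) auto
  also have "\<dots> \<le> n div 6 + card {1..5::nat}"
    by (intro order_trans[OF card_Un_le] add_mono card_image_le) auto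
  also have "\<dots> \<le> d"
    using assms by simp
  finally show ?thesis .
qed

context weighting
begin

text \<open>Equal gcds mean equal orders, and then compatibility identifies the unit parts, which
  lie between 1 and the order. Hence X has at most as many elements as n has divisors.\<close>

lemma inj_on_gcd_of_compatible:
  assumes "\<And>g h. g \<in> X \<Longrightarrow> h \<in> X \<Longrightarrow> compatible n (x g) (x h)"
  shows "inj_on (\<lambda>g. gcd (x g) n) X"
proof (rule inj_onI)
  fix g h
  assume gh: "g \<in> X" "h \<in> X" and w: "gcd (x g) n = gcd (x h) n"
  then have r: "ord_of n (x g) = ord_of n (x h)"
    by (simp add: ord_of_def)
  have bnd: "0 < unit_of n (x k) \<and> unit_of n (x k) \<le> ord_of n (x k)" if "k \<in> X" for k
  proof
    show "0 < unit_of n (x k)"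
      using x_pos[OF that] unit_of_mult[of "x k" n] by (intro gr0I) auto
    show "unit_of n (x k) \<le> ord_of n (x k)"
      unfolding unit_of_def ord_of_def using x_le[OF that] by (rule div_le_mono)
  qed
  have "[unit_of n (x g) = unit_of n (x h)] (mod ord_of n (x h))"
    using assms[OF gh] r by (simp add: compatible_def)
  then have "unit_of n (x g) = unit_of n (x h)"
    using bnd[OF gh(1)] bnd[OF gh(2)] r
    by (intro cong_imp_eq_nat) auto
  then have "gcd (x g) n * unit_of n (x g) = gcd (x h) n * unit_of n (x h)"
    by (simp only: w)
  then have "x g = x h"
    by (simp only: unit_of_mult)
  then show "g = h"
    using x_inj gh by (auto dest: inj_onD)
qed

text \<open>
  Complementing an atom \<open>U\<close> to the product of the \<open>h\<^bsup>ord h\<^esup>\<close> with \<open>h\<close> in its support gives two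
  factorizations whose lengths differ by less than the size of the support.
\<close>

lemma half_factorial_of_compatible:
  assumes compat: "\<And>g h. g \<in> X \<Longrightarrow> h \<in> X \<Longrightarrow> compatible n (x g) (x h)"
    and H: "lengths_cong d Z" and d: "n \<le> 5 * d" "150 \<le> n" and d': "0 < d'"
  shows "\<not> has_distance d' Z"
proof -
  define w where "w g = gcd (x g) n" for g
  define r where "r g = ord_of n (x g)" for g
  \<comment> \<open>W S / n is the cross number of S, the sum of 1 / ord g over its terms g.\<close>
  define W where "W S = (\<Sum>g\<in>#S. w g)" for S
  have W_add: "W (S + T) = W S + W T" for S T
    by (simp add: W_def)
  have W_dvd: "n dvd W S" if "set_mset S \<subseteq> X" "n dvd wt S" for S
    unfolding W_def w_def using n_pos that compat by (intro dvd_sum_gcd) auto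
  have W_ge: "n \<le> W S" if "S \<in> atoms Z" for S
  proof -
    have "S \<noteq> {#}" "n dvd W S"
      using atomsD[OF that] W_dvd by auto
    moreover have "0 < W S"
      using \<open>S \<noteq> {#}\<close> n_pos by (cases S) (auto simp: W_def w_def)
    ultimately show ?thesis
      by (simp add: dvd_imp_le)
  qed
  have W_sum_ge: "n * size F \<le> W (\<Sum>\<^sub># F)" if "set_mset F \<subseteq> atoms Z" for F
    using that
  proof (induction F)
    case (add A F)
    then show ?case
      using W_ge[of A] by (simp add: W_add)
  qed simp
  have r_pos: "0 < r g" for g
    using ord_of_pos[OF n_pos] by (simp add: r_def)
  have R: "replicate_mset (r h) h \<in> atoms Z" if "h \<in> X" for h
  proof (rule atomsI)
    show "n dvd wt (replicate_mset (r h) h)"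
      using dvd_mult_iff_ord_of[OF n_pos, of "r h" "x h"] by (simp add: r_def)
    show "replicate_mset (r h) h \<noteq> {#}" "set_mset (replicate_mset (r h) h) \<subseteq> X"
      using r_pos[of h] that by auto
    fix T
    assume T: "T \<subseteq># replicate_mset (r h) h" "n dvd wt T"
    then obtain k where k: "k \<le> r h" "T = replicate_mset k h"
      by (elim msubseteq_replicate_msetE) auto
    then have "r h dvd k"
      using T(2) dvd_mult_iff_ord_of[OF n_pos, of k "x h"] by (simp add: r_def)
    then show "T = {#} \<or> T = replicate_mset (r h) h"
      using k by (cases "k = 0") (auto dest: dvd_imp_le)
  qed
  have W_atom: "W U = n" if U: "U \<in> atoms Z" for U
  proof -
    define s where "s = card (set_mset U)"
    define P where "P = (\<Sum>h\<in>set_mset U. replicate_mset (r h) h)"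
    define F' where "F' = image_mset (\<lambda>h. replicate_mset (r h) h) (mset_set (set_mset U))"
    have UX: "set_mset U \<subseteq> X" "n dvd wt U" "U \<noteq> {#}"
      using atomsD[OF U] by auto
    have count_P: "count P h = (if h \<in># U then r h else 0)" for h
      by (simp add: P_def count_sum)
    \<comment> \<open>An atom with at least ord h terms h is h^(ord h) itself; every other atom has
      fewer terms h.\<close>
    have "U \<subseteq># P"
    proof (rule mset_subset_eqI)
      fix h
      show "count U h \<le> count P h"
      proof (cases "h \<in># U \<and> r h \<le> count U h")
        case True
        then have "replicate_mset (r h) h \<subseteq># U"
          by (simp add: count_le_replicate_mset_subset_eq)
        moreover have "n dvd wt (replicate_mset (r h) h)" "replicate_mset (r h) h \<noteq> {#}"
          using R[of h] True UX atomsD(2,3) by blast+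
        ultimately have "replicate_mset (r h) h = U"
          using atomsD(4)[OF U] by blast
        then have "count U h = r h"
          by (metis count_replicate_mset)
        then show ?thesis
          using True by (simp add: count_P)
      next
        case False
        then show ?thesis
          by (auto simp: count_P not_in_iff)
      qed
    qed
    then obtain V where V: "P = U + V"
      by (metis subset_mset.le_iff_add)
    have F': "set_mset F' \<subseteq> atoms Z" "\<Sum>\<^sub># F' = P" "size F' = s"
      using R UX(1) by (auto simp: F'_def P_def s_def sum_unfold_sum_mset)
    have "n dvd wt P"
      using F'(1) atomsD(2) unfolding F'(2)[symmetric]
      by (induction F') auto
    then have "n dvd wt V"
      using UX(2) V by (simp add: dvd_add_right_iff)
    moreover have "set_mset P = set_mset U"
      using r_pos by (auto simp: count_P simp flip: count_greater_zero_iff split: if_splits)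
    then have "set_mset V \<subseteq> X"
      using V UX(1) by (metis le_sup_iff set_mset_union)
    ultimately obtain F where F: "set_mset F \<subseteq> atoms Z" "\<Sum>\<^sub># F = V"
      using ex_factorization by blast
    have "W P = (\<Sum>h\<in>set_mset U. r h * w h)"
      unfolding P_def W_def by (induction rule: finite_induct[OF finite_set_mset[of U]]) auto
    also have "\<dots> = s * n"
      by (simp add: s_def r_def w_def ord_of_mult mult.commute[of "ord_of _ _"])
    finally have WP: "W U + W V = s * n"
      using V by (simp add: W_add)
    have "[size (add_mset U F) = size F'] (mod d)"
      using H U F F' V by (intro lengths_congD[of _ Z]) auto
    then have cong: "[Suc (size F) = s] (mod d)"
      using F'(3) by simp
    have "n * size F + n \<le> n * s"
      using W_sum_ge[OF F(1)] W_ge[OF U] F(2) WP by (simp add: mult.commute)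
    then have le: "Suc (size F) \<le> s"
      using n_pos by (metis mult_Suc_right add.commute nat_mult_le_cancel_disj less_irrefl)
    have "inj_on w (set_mset U)"
      using inj_on_gcd_of_compatible[OF compat] UX(1) unfolding w_def by (rule inj_on_subset)
    then have "s = card (w ` set_mset U)"
      by (simp add: s_def card_image)
    also have "\<dots> \<le> card {k. k dvd n}"
      using n_pos by (intro card_mono) (auto simp: w_def)
    also have "\<dots> \<le> d"
      using card_divisors_le[OF d] .
    finally have "s \<le> d" .
    \<comment> \<open>The two lengths are congruent modulo d and lie between 1 and s \<le> d, so
      they agree. Then s atoms, each with W at least n, share the total s n, which pins W U to
      n.\<close>
    have "d dvd s - Suc (size F)"
      using cong le by (simp add: cong_altdef_nat cong_sym_eq[of "Suc (size F)"])
    then have "s = Suc (size F)"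
      using le \<open>s \<le> d\<close> by (cases "s - Suc (size F) = 0") (auto dest: dvd_imp_le)
    then have "W U \<le> n"
      using WP W_sum_ge[OF F(1)] F(2) by (simp add: mult.commute)
    then show "W U = n"
      using W_ge[OF U] by simp
  qed
  have W_sum: "W (\<Sum>\<^sub># F) = n * size F" if "set_mset F \<subseteq> atoms Z" for F
    using that
  proof (induction F)
    case empty
    then show ?case by (simp add: W_def)
  next
    case (add A F)
    then show ?case
      using W_atom[of A] by (simp add: W_add)
  qed
  show ?thesis
  proof
    assume "has_distance d' Z"
    then obtain F F' where "set_mset F \<subseteq> atoms Z" "set_mset F' \<subseteq> atoms Z" "\<Sum>\<^sub># F = \<Sum>\<^sub># F'"
        "size F' = size F + d'"
      unfolding has_distance_def by blast
    then have "n * size F = n * (size F + d')"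
      using W_sum[of F] W_sum[of F'] by simp
    then show False
      using n_pos d' by simp
  qed
qed

end

section \<open>The sets \<open>{e, -c e}\<close> and \<open>{e, -e, (n/2) e}\<close>\<close>

lemma subset_replicate_mset_add:
  assumes "T \<subseteq># replicate_mset p y + S"
  obtains i T' where "i \<le> p" "T' \<subseteq># S" "T = replicate_mset i y + T'"
proof -
  have "T \<inter># replicate_mset p y \<subseteq># replicate_mset p y"
    by simp
  then obtain i where "i \<le> p" "T \<inter># replicate_mset p y = replicate_mset i y"
    by (elim msubseteq_replicate_msetE) auto
  moreover have "T - replicate_mset p y \<subseteq># S"
    using assms by (simp add: subset_eq_diff_conv add.commute)
  moreover have "T = (T \<inter># replicate_mset p y) + (T - replicate_mset p y)"
    by (rule multiset_eqI) auto
  ultimately show ?thesis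
    using that by metis
qed

lemma int_dvd_small:
  fixes k m :: int
  assumes "m dvd k" "\<bar>k\<bar> < m"
  shows "k = 0"
proof (rule ccontr)
  assume "k \<noteq> 0"
  then have "\<bar>m\<bar> \<le> \<bar>k\<bar>"
    using assms(1) by (rule dvd_imp_le_int)
  then show False
    using assms(2) by linarith
qed

section \<open>Change of generator, restriction to a subgroup, and lengths over the special
  sets\<close>

context weighting
begin

text \<open>Multiplication by a unit modulo n is an automorphism. The class 0 is again represented
  by n, which keeps the weights positive.\<close>

lemma rebase:
  assumes "coprime u n"
  shows "\<exists>x'. weighting Z X n x' \<and> (\<forall>k\<in>X. [x' k = u * x k] (mod n))"
proof -
  define x' where "x' k = (if n dvd u * x k then n else (u * x k) mod n)" for k
  have cong: "[x' k = u * x k] (mod n)" for k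
    by (auto simp: x'_def cong_def)
  have "[(\<Sum>k\<in>#S. x' k) = u * wt S] (mod n)" for S
    by (induction S) (auto simp: distrib_left intro: cong_add cong)
  then have "n dvd (\<Sum>k\<in>#S. x' k) \<longleftrightarrow> n dvd wt S" for S
    using assms by (metis cong_dvd_iff coprime_commute coprime_dvd_mult_right_iff)
  then have "Z = {S. set_mset S \<subseteq> X \<and> n dvd (\<Sum>k\<in>#S. x' k)}"
    using Z_eq by simp
  moreover have "0 < x' k" "x' k \<le> n" for k
    using n_pos by (auto simp: x'_def dvd_eq_mod_eq_0 intro: less_imp_le)
  moreover have "inj_on x' X"
  proof (rule inj_onI)
    fix g h
    assume gh: "g \<in> X" "h \<in> X" "x' g = x' h"
    then have "[u * x g = u * x h] (mod n)"
      using cong[of g] cong[of h] by (metis cong_sym cong_trans)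
    then have "[x g = x h] (mod n)"
      using assms by (simp add: cong_mult_lcancel_nat)
    then have "x g = x h"
      using gh x_pos x_le by (intro cong_imp_eq_nat) auto
    then show "g = h"
      using gh x_inj by (auto dest: inj_onD)
  qed
  ultimately have "weighting Z X n x'"
    using n_pos by unfold_locales auto
  then show ?thesis
    using cong by blast
qed

lemma rebase_generator:
  assumes "g \<in> X" "h \<in> X" "coprime (x g) n" "[x g * a = x h] (mod n)" "0 < a" "a \<le> n"
  shows "\<exists>x'. weighting Z X n x' \<and> x' g = 1 \<and> x' h = a"
proof -
  obtain u where u: "[x g * u = 1] (mod n)"
    using cong_solve_coprime_nat[OF assms(3)] by auto
  have "coprime (x g * u) n"
    using u by (metis cong_imp_coprime cong_sym coprime_1_left)
  then have "coprime u n"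
    by simp
  then obtain x' where x': "weighting Z X n x'" "\<forall>k\<in>X. [x' k = u * x k] (mod n)"
    using rebase by blast
  interpret x': weighting Z X n x'
    by (rule x')
  have "[x' g = 1] (mod n)"
    using x'(2) assms(1) u by (metis cong_trans mult.commute)
  then have "x' g = 1"
    using assms(1) x'.x_pos x'.x_le n_pos by (intro cong_imp_eq_nat) auto
  have "[u * x h = u * (x g * a)] (mod n)"
    using assms(4) by (intro cong_mult) (auto simp: cong_sym_eq)
  moreover have "[u * (x g * a) = 1 * a] (mod n)"
    using cong_mult[OF u cong_refl[of a]] by (simp add: ac_simps)
  ultimately have "[x' h = a] (mod n)"
    using x'(2) assms(2) by (metis cong_trans mult_1)
  then have "x' h = a"
    using assms x'.x_pos x'.x_le n_pos by (intro cong_imp_eq_nat) auto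
  then show ?thesis
    using x'(1) \<open>x' g = 1\<close> by blast
qed

text \<open>Weights divisible by q belong to the subgroup of order N, in which weight q becomes the
  weight 1 of a generator.\<close>

lemma weighting_div:
  assumes "n = q * N" "\<And>k. k \<in> X \<Longrightarrow> q dvd x k"
  shows "weighting Z X N (\<lambda>k. x k div q)"
proof -
  have q: "0 < q" "0 < N"
    using assms(1) n_pos by auto
  have xq: "x k = q * (x k div q)" if "k \<in> X" for k
    using assms(2)[OF that] by simp
  have "wt S = q * (\<Sum>k\<in>#S. x k div q)" if "set_mset S \<subseteq> X" for S
    using that xq by (induction S) (auto simp: distrib_left)
  then have "n dvd wt S \<longleftrightarrow> N dvd (\<Sum>k\<in>#S. x k div q)" if "set_mset S \<subseteq> X" for S
    using that assms(1) q by simp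
  then have "Z = {S. set_mset S \<subseteq> X \<and> N dvd (\<Sum>k\<in>#S. x k div q)}"
    using Z_eq by auto
  moreover have "0 < x k div q" "x k div q \<le> N" if "k \<in> X" for k
    using x_pos[OF that] x_le[OF that] xq[OF that] assms(1) q
    by (auto intro!: gr0I, metis nat_mult_le_cancel_disj)
  moreover have "inj_on (\<lambda>k. x k div q) X"
  proof (rule inj_onI)
    fix g h
    assume gh: "g \<in> X" "h \<in> X" "x g div q = x h div q"
    then have "q * (x g div q) = q * (x h div q)"
      by simp
    then have "x g = x h"
      using assms(2)[OF gh(1)] assms(2)[OF gh(2)] by (simp only: dvd_mult_div_cancel)
    then show "g = h"
      using gh x_inj by (auto dest: inj_onD)
  qed
  ultimately show ?thesis
    using q by unfold_locales auto
qed

lemma index_cong_weight: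
  assumes "lengths_cong d Z" "e \<in> X" "x e = 1" "k \<in> X" "1 < x k" "x k < n"
  shows "index_cong d n (x k)"
  using assms by (intro index_cong_pair[of d e k 1 1]) (auto simp: mult.commute)

text \<open>s rounds x k up to a multiple c m of c, so that one term k, s terms e and m terms -c e
  cancel over the integers. Every zero-sum part has integer sum of absolute value below n, hence
  also 0. The index m of this atom is what constrains a further element k of X.\<close>

lemma atom_neg:
  assumes "e \<in> X" "x e = 1" "h \<in> X" "x h = n - c" "k \<in> X" "0 < c" "c < n"
    and "x k + s = c * m" "s < c" "x k + s < n"
  shows "{#k#} + (replicate_mset m h + replicate_mset s e) \<in> atoms Z" (is "?A \<in> _")
    and "wt ({#k#} + (replicate_mset m h + replicate_mset s e)) = m * n"
proof -
  have "m * (n - c) + c * m = m * n"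
    using assms(7) by (simp add: diff_mult_distrib2 mult.commute[of c])
  then show eq: "wt ?A = m * n"
    using assms(2,4,8) by simp
  show "?A \<in> atoms Z"
  proof (rule atomsI)
    show "set_mset ?A \<subseteq> X"
      using assms by auto
    show "n dvd wt ?A"
      unfolding eq by simp
    fix T
    assume T: "T \<subseteq># ?A" "n dvd wt T"
    have "T \<subseteq># replicate_mset 1 k + (replicate_mset m h + replicate_mset s e)"
      using T(1) by simp
    then obtain i T' where i: "i \<le> 1" "T' \<subseteq># replicate_mset m h + replicate_mset s e"
        "T = replicate_mset i k + T'"
      by (rule subset_replicate_mset_add)
    from i(2) obtain l T'' where l: "l \<le> m" "T'' \<subseteq># replicate_mset s e"
        "T' = replicate_mset l h + T''"
      by (rule subset_replicate_mset_add)
    from l(2) obtain j where j: "j \<le> s" "T'' = replicate_mset j e"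
      by (elim msubseteq_replicate_msetE) auto
    have wtT: "wt T = i * x k + (l * (n - c) + j)"
      using i(3) l(3) j(2) assms(2,4) by simp
    have "int (wt T) = int (i * x k) + int j - int (c * l) + int n * int l"
      unfolding wtT using assms(7) by (simp add: of_nat_diff right_diff_distrib mult.commute)
    then have dvd: "int n dvd int (i * x k) + int j - int (c * l)"
      using T(2) by (metis dvd_add_left_iff dvd_triv_left int_dvd_int_iff)
    have cl: "c * l \<le> c * m"
      using l(1) by simp
    have bounds: "int (c * l) \<le> int (x k) + int s" "int (x k) + int s < int n" "int j \<le> int s"
        "int s < int c" "0 \<le> int (c * l)" "int c < int n"
      using cl assms(7-10) j(1) by linarith+
    consider "i = 0" | "i = 1"
      using i(1) by linarith
    then show "T = {#} \<or> T = ?A"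
    proof cases
      case 1
      have "int (i * x k) + int j - int (c * l) = 0"
        using bounds unfolding 1 mult_0 of_nat_0 by (intro int_dvd_small[OF dvd[unfolded 1 mult_0 of_nat_0]]) linarith
      then have "int j = int (c * l)"
        unfolding 1 mult_0 of_nat_0 by linarith
      then have "j = c * l"
        by (simp only: of_nat_eq_iff)
      then have "l = 0" "j = 0"
        using j(1) assms(9) by (cases l; simp)+
      then show ?thesis
        using 1 i l j by simp
    next
      case 2
      have "int (i * x k) + int j - int (c * l) = 0"
        using bounds unfolding 2 mult_1 by (intro int_dvd_small[OF dvd[unfolded 2 mult_1]]) linarith
      then have "int (c * l) = int (x k + j)"
        unfolding 2 mult_1 of_nat_add by linarith
      then have "c * l = x k + j"
        by (simp only: of_nat_eq_iff)
      then have cml: "c * m = c * l + (s - j)"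
        using assms(8) j(1) by simp
      have "l = m"
      proof (rule ccontr)
        assume "l \<noteq> m"
        then have "c * Suc l \<le> c * m"
          using l(1) by (intro mult_le_mono2) simp
        then show False
          using cml assms(9) by simp
      qed
      then have "s = j"
        using cml j(1) by simp
      then show ?thesis
        using \<open>l = m\<close> 2 i l j by simp
    qed
  qed simp
qed

lemma replicate_of_same_weight:
  assumes "set_mset R \<subseteq> X" "\<And>k. k \<in># R \<Longrightarrow> x k = w"
  obtains p y where "R = replicate_mset p y" "0 < p \<longrightarrow> x y = w"
proof (cases "R = {#}")
  case True
  then show ?thesis using that[of 0] by simp
next
  case False
  then obtain y where y: "y \<in># R"
    by auto
  have "set_mset R \<subseteq> {y}"
  proof
    fix k assume "k \<in># R"
    then have "x k = x y" "k \<in> X" "y \<in> X"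
      using assms y by auto
    then show "k \<in> {y}"
      using inj_onD[OF x_inj] by blast
  qed
  then have "R = replicate_mset (size R) y"
    by (rule set_mset_subset_singletonD)
  then show ?thesis
    using that[of "size R" y] assms(2)[OF y] by blast
qed

text \<open>An atom containing 0, both e and -e, or the involution g twice has weight n. There
  remain e^n, (-e)^n, g e^(n/2) and g (-e)^(n/2), of index 1, n - 1, 1 and n / 2.\<close>

lemma lengths_cong_involution:
  assumes x: "\<And>k. k \<in> X \<Longrightarrow> x k = 1 \<or> x k = n - 1 \<or> x k = n \<or> 2 * x k = n \<and> D dvd x k - 1"
    and D: "D dvd n - 2" and n: "2 < n"
  shows "lengths_cong D Z"
proof (rule lengths_congI)
  fix A
  assume A: "A \<in> atoms Z"
  have AX: "set_mset A \<subseteq> X" "n dvd wt A"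
    using atomsD[OF A] by auto
  have A_eq: "A = T" if "T \<subseteq># A" "n dvd wt T" "T \<noteq> {#}" for T
    using atomsD(4)[OF A that(1,2)] that(3) by blast
  define P where "P = filter_mset (\<lambda>k. 2 * x k = n) A"
  define Q where "Q = filter_mset (\<lambda>k. 2 * x k \<noteq> n) A"
  have PQ: "A = P + Q"
    by (simp add: P_def Q_def multiset_partition[symmetric])
  obtain p g where P: "P = replicate_mset p g"
    by (rule replicate_of_same_weight[of P "n div 2"]) (use AX(1) in \<open>auto simp: P_def\<close>)
  have g: "2 * x g = n" if "0 < p"
  proof -
    have "g \<in># P"
      unfolding P using that by simp
    then show ?thesis
      by (simp add: P_def)
  qed
  show "[wt A div n = 1] (mod D)"
  proof (cases "2 \<le> p \<or> (\<exists>k\<in>#A. x k = n) \<or> (\<exists>e h. e \<in># A \<and> h \<in># A \<and> x e = 1 \<and> x h = n - 1)")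
    case True
    then have "\<exists>T. T \<subseteq># A \<and> wt T = n"
    proof (elim disjE)
      assume "2 \<le> p"
      then have "replicate_mset 2 g \<subseteq># P"
        unfolding P by (simp add: replicate_mset_msubseteq_iff)
      then have "replicate_mset 2 g \<subseteq># A"
        unfolding PQ by (rule subset_mset.order_trans) simp
      then show ?thesis
        using g \<open>2 \<le> p\<close> by (intro exI[of _ "replicate_mset 2 g"]) auto
    next
      assume "\<exists>k\<in>#A. x k = n"
      then obtain k where "k \<in># A" "x k = n" ..
      then show ?thesis
        by (intro exI[of _ "{#k#}"]) auto
    next
      assume "\<exists>e h. e \<in># A \<and> h \<in># A \<and> x e = 1 \<and> x h = n - 1"
      then obtain e h where eh: "e \<in># A" "h \<in># A" "x e = 1" "x h = n - 1"
        by blast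
      then have "e \<noteq> h"
        using n by auto
      then have "{#e, h#} \<subseteq># A"
        using eh(1,2) by (simp add: insert_subset_eq_iff in_diff_count)
      then show ?thesis
        using eh(3,4) n by (intro exI[of _ "{#e, h#}"]) auto
    qed
    then obtain T where "T \<subseteq># A" "wt T = n"
      by blast
    then have "A = T"
      using n by (intro A_eq) auto
    then have "wt A = n"
      using \<open>wt T = n\<close> by (simp only:)
    then show ?thesis
      using n by simp
  next
    case False
    then have p: "p \<le> 1"
      by auto
    have xQ: "x k = 1 \<or> x k = n - 1" if "k \<in># Q" for k
      using that x[of k] AX(1) False by (auto simp: Q_def)
    have "\<exists>w\<in>{1, n - 1}. \<forall>k\<in>#Q. x k = w"
      using xQ False by (auto simp: Q_def)
    then obtain w where w: "w = 1 \<or> w = n - 1" "\<forall>k\<in>#Q. x k = w"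
      by blast
    have "set_mset Q \<subseteq> X"
      using AX(1) by (auto simp: Q_def)
    from replicate_of_same_weight[OF this, of w] obtain q y
      where Q: "Q = replicate_mset q y" "0 < q \<longrightarrow> x y = w"
      using w(2) by blast
    have A_pq: "A = replicate_mset p g + replicate_mset q y"
      using PQ P Q(1) by simp
    have wtA: "wt A = p * x g + q * x y"
      unfolding A_pq by simp
    have sub: "replicate_mset p g + replicate_mset q' y \<subseteq># A" if "q' \<le> q" for q'
      using that unfolding A_pq by (simp add: replicate_mset_msubseteq_iff)
    have sum: "A = replicate_mset p g + replicate_mset q' y \<and> wt A = p * x g + q' * x y"
      if "q' \<le> q" "n dvd p * x g + q' * x y" "0 < p + q'" for q'
    proof -
      have "A = replicate_mset p g + replicate_mset q' y"
        using that by (intro A_eq sub) auto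
      then show ?thesis by simp
    qed
    have q0: "0 < q"
    proof (rule gr0I)
      assume "q = 0"
      then have "p * x g = wt A"
        using wtA by simp
      moreover have "p = 1"
        using p atomsD(3)[OF A] \<open>q = 0\<close> unfolding A_pq by (cases "p = 0") auto
      ultimately have "n dvd x g" "2 * x g = n"
        using AX(2) g by auto
      then show False
        using n by (auto dest: dvd_imp_le)
    qed
    then have "x y = 1 \<or> x y = n - 1"
      using Q(2) w(1) by auto
    then show ?thesis
    proof
      assume y1: "x y = 1"
      have pg: "p * x g \<le> n" "p * x g = 0 \<or> p * x g < n"
      proof -
        consider "p = 0" | "p = 1"
          using p by linarith
        then show "p * x g \<le> n" "p * x g = 0 \<or> p * x g < n"
          by (cases; use g n in auto)+
      qed
      have "n \<le> wt A"
        using AX(2) wtA q0 y1 by (intro dvd_imp_le) auto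
      then have "n - p * x g \<le> q"
        using wtA y1 by simp
      then have "wt A = n"
        using sum[of "n - p * x g"] pg y1 n by auto
      then show ?thesis
        using n by simp
    next
      assume yn: "x y = n - 1"
      have wAq: "wt A + q = p * x g + q * n"
      proof -
        have "q * (n - 1) + q = q * n"
          using n by (cases n) auto
        then show ?thesis
          unfolding wtA yn by linarith
      qed
      show ?thesis
      proof (cases "p = 0")
        case True
        then have "n dvd wt A + q"
          using wAq by simp
        then have "n dvd q"
          using AX(2) by (simp only: dvd_add_right_iff)
        then have "n \<le> q"
          using q0 by (simp add: dvd_imp_le)
        then have "wt A = n * (n - 1)"
          using sum[of n] True yn n by auto
        then have "wt A div n = n - 1"
          using n by simp
        then show ?thesis
          using D n by (simp add: cong_1_nat_iff numeral_2_eq_2)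
      next
        case False
        then have p1: "p = 1"
          using p by simp
        have g2: "2 * x g = n" "g \<in># A"
          using g p1 A_pq by auto
        then have Dg: "D dvd x g - 1"
        proof -
          have "x g \<noteq> 1" "x g \<noteq> n - 1" "x g \<noteq> n"
            using g2(1) n by linarith+
          then show ?thesis
            using x[of g] g2(2) AX(1) by blast
        qed
        have "x g \<le> q"
        proof (rule ccontr)
          assume "\<not> x g \<le> q"
          then have "wt A = (x g - q) + q * n"
            using wAq unfolding p1 by linarith
          then have "n dvd (x g - q) + q * n"
            using AX(2) by (simp only:)
          then have "n dvd x g - q"
            by (simp add: dvd_add_left_iff)
          then show False
            using \<open>\<not> x g \<le> q\<close> g2(1) n by (auto dest!: dvd_imp_le)
        qed
        have e: "x g + x g * (n - 1) = n * x g"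
          using n by (cases n) auto
        have "wt A = n * x g"
          using sum[of "x g"] \<open>x g \<le> q\<close> e p1 yn by simp
        then have "wt A div n = x g"
          using n by simp
        then show ?thesis
          using Dg g2 n by (simp add: cong_1_nat_iff)
      qed
    qed
  qed
qed

text \<open>Besides 0, e^n and e^c (-c e), all of index 1, an atom has the form e^i (-c e)^j with i
  < c. For w = c - i it has j = w u + 1 and index w (u - 1) + 1.\<close>

lemma lengths_cong_neg:
  assumes x: "\<And>k. k \<in> X \<Longrightarrow> x k = 1 \<or> x k = n - c \<or> x k = n"
    and n: "n = c * u + 1" and c: "0 < c" and u: "2 \<le> u"
  shows "lengths_cong (u - 1) Z"
proof (rule lengths_congI)
  fix A
  assume A: "A \<in> atoms Z"
  have AX: "set_mset A \<subseteq> X" "n dvd wt A"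
    using atomsD[OF A] by auto
  have A_eq: "A = T" if "T \<subseteq># A" "n dvd wt T" "T \<noteq> {#}" for T
    using atomsD(4)[OF A that(1,2)] that(3) by blast
  have "c * 2 \<le> c * u"
    using u by (rule mult_le_mono2)
  then have cn: "c < n"
    using n c by linarith
  show "[wt A div n = 1] (mod (u - 1))"
  proof (cases "\<exists>k\<in>#A. x k = n")
    case True
    then obtain k where k: "k \<in># A" "x k = n" ..
    then have "A = {#k#}"
      by (intro A_eq) auto
    then have "wt A = n"
      using k(2) by simp
    then show ?thesis
      using n_pos by simp
  next
    case False
    obtain i e where P: "filter_mset (\<lambda>k. x k = 1) A = replicate_mset i e" "0 < i \<longrightarrow> x e = 1"
      by (rule replicate_of_same_weight[of "filter_mset (\<lambda>k. x k = 1) A" 1]) (use AX(1) in auto)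
    have xA: "x k = n - c" if "k \<in># A" "x k \<noteq> 1" for k
      using x[of k] False AX(1) that by blast
    obtain j h where Q: "filter_mset (\<lambda>k. x k \<noteq> 1) A = replicate_mset j h" "0 < j \<longrightarrow> x h = n - c"
      by (rule replicate_of_same_weight[of "filter_mset (\<lambda>k. x k \<noteq> 1) A" "n - c"])
        (use AX(1) xA in auto)
    have A_ij: "A = replicate_mset i e + replicate_mset j h"
      using multiset_partition[of A "\<lambda>k. x k = 1"] unfolding P(1) Q(1) .
    have wt: "wt (replicate_mset i' e + replicate_mset j' h) = i' + j' * (n - c)"
      if "i' \<le> i" "j' \<le> j" for i' j'
      using that P(2) Q(2) by (cases "i' = 0"; cases "j' = 0") auto
    have sum: "wt A = i' + j' * (n - c)"
      if le: "i' \<le> i" "j' \<le> j" and dvd: "n dvd i' + j' * (n - c)" and pos: "0 < i' + j'" for i' j'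
    proof -
      have "A = replicate_mset i' e + replicate_mset j' h"
      proof (rule A_eq)
        show "replicate_mset i' e + replicate_mset j' h \<subseteq># A"
          unfolding A_ij using le by (intro subset_mset.add_mono) (simp_all add: replicate_mset_msubseteq_iff)
        show "n dvd wt (replicate_mset i' e + replicate_mset j' h)"
          unfolding wt[OF le] by (rule dvd)
        show "replicate_mset i' e + replicate_mset j' h \<noteq> {#}"
          using pos by auto
      qed
      then show ?thesis
        using wt[OF le] by (simp only:)
    qed
    have ij0: "0 < i + j"
      using atomsD(3)[OF A] unfolding A_ij by (intro gr0I) simp
    have wtA: "wt A = i + j * (n - c)"
      using wt[OF order_refl order_refl] A_ij by (simp only:)
    consider "j = 0" | "0 < j" "c \<le> i" | "0 < j" "i < c"
      by linarith
    then show ?thesis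
    proof cases
      case 1
      then have "n \<le> i"
        using AX(2) wtA ij0 by (auto dest: dvd_imp_le)
      then have "wt A = n"
        using sum[of n 0] n_pos by simp
      then show ?thesis
        using n_pos by simp
    next
      case 2
      then have "wt A = n"
        using sum[of c 1] cn c by simp
      then show ?thesis
        using n_pos by simp
    next
      case 3
      define w where "w = c - i"
      obtain u' where u': "u = Suc u'"
        using u by (cases u) auto
      have ciw: "c = i + w"
        using 3 by (simp add: w_def)
      define y where "y = w * u + 1"
      have ny: "c * y = i + w * n"
        unfolding y_def n by (simp add: ciw algebra_simps)
      \<comment> \<open>For j < y the relation c j - i = n v has 0 < v < w. As n is 1 modulo c, it
        follows that c divides v + i, although 0 < v + i < c.\<close>
      have "y \<le> j"
      proof (rule ccontr)
        assume "\<not> y \<le> j"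
        then have "c * j < c * y"
          using c by simp
        then have cj: "c * j < i + w * n"
          unfolding ny .
        have "int (wt A) = int n * int j - (int (c * j) - int i)"
          unfolding wtA using cn by (simp add: of_nat_diff right_diff_distrib mult.commute)
        then have "int n dvd int (c * j) - int i"
          using AX(2) by (metis dvd_diff_right_iff dvd_triv_left int_dvd_int_iff)
        then obtain v where v: "int (c * j) - int i = int n * v"
          by (auto elim: dvdE)
        have "c * 1 \<le> c * j"
          using 3 by (intro mult_le_mono2) simp
        then have "0 < int n * v"
          using v 3 by linarith
        then have v0: "0 < v"
          using n_pos by (simp add: zero_less_mult_iff)
        have "int (c * j) < int (i + w * n)"
          using cj by (simp only: of_nat_less_iff)
        then have "int n * v < int n * int w"
          using v by (simp add: mult.commute)
        then have vw: "v < int w"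
          using n_pos by (simp add: mult_less_cancel_left)
        have "v + int i = int c * (int j - int u * v)"
          using v unfolding n by (simp add: algebra_simps)
        then have "int c dvd v + int i"
          by simp
        then have "v + int i = 0"
          using v0 vw ciw by (intro int_dvd_small[of "int c"]) auto
        then show False
          using v0 by simp
      qed
      have e: "i + y * (n - c) = n * (w * u' + 1)"
      proof -
        have "n - c = c * u' + 1"
          unfolding n u' by simp
        then show ?thesis
          unfolding y_def n u' by (simp add: ciw algebra_simps)
      qed
      then have "wt A = n * (w * u' + 1)"
        using sum[of i y] \<open>y \<le> j\<close> by (simp add: y_def)
      then have "wt A div n = w * u' + 1"
        using n_pos by simp
      then show ?thesis
        unfolding u' by (simp add: cong_1_nat_iff)
    qed
  qed
qed

lemma sum_mset_replicate_mset_add: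
  "\<Sum>\<^sub># (replicate_mset m (replicate_mset i e + replicate_mset j h)) =
    replicate_mset (m * i) e + replicate_mset (m * j) h"
  by (induction m) (simp_all add: replicate_mset_add)

text \<open>The relation is (e^c h)^(u+1) = e^n (e^(c-1) h^(u+1)), where n + c - 1 = c (u + 1). The
  lengths are u + 1 and 2.\<close>

lemma has_distance_neg:
  assumes "e \<in> X" "x e = 1" "h \<in> X" "x h = n - c" and n: "n = c * u + 1" and c: "0 < c" and u: "2 \<le> u"
  shows "has_distance (u - 1) Z"
proof -
  define V where "V = replicate_mset c e + replicate_mset 1 h"
  define B where "B = replicate_mset (c - 1) e + replicate_mset (u + 1) h"
  define F where "F = {#replicate_mset n e, B#}"
  define F' where "F' = replicate_mset (u + 1) V"
  have "c * 2 \<le> c * u"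
    using u by (rule mult_le_mono2)
  then have cn: "2 * c < n"
    using n by linarith
  have E: "replicate_mset n e \<in> atoms Z"
    using assms(1,2) by (intro atom_of_wt_eq) auto
  have V: "V \<in> atoms Z"
    using assms(1-4) cn unfolding V_def by (intro atom_of_wt_eq) auto
  have B: "B \<in> atoms Z"
  proof (rule atomsI)
    show "set_mset B \<subseteq> X" "B \<noteq> {#}"
      using assms(1,3) by (auto simp: B_def)
    have "(u + 1) * (n - c) + (u + 1) * c = (u + 1) * n"
      using cn by (simp flip: distrib_left)
    then have "(c - 1) + (u + 1) * (n - c) = u * n"
      using n c by (simp add: mult.commute[of u c])
    then have "wt B = u * n"
      using assms(2,4) by (simp add: B_def)
    then show "n dvd wt B"
      by simp
    fix T
    assume T: "T \<subseteq># B" "n dvd wt T"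
    from T(1) obtain i T' where i: "i \<le> c - 1" "T' \<subseteq># replicate_mset (u + 1) h"
        "T = replicate_mset i e + T'"
      unfolding B_def by (rule subset_replicate_mset_add)
    from i(2) obtain j where j: "j \<le> u + 1" "T' = replicate_mset j h"
      by (elim msubseteq_replicate_msetE) auto
    have wtT: "wt T = i + j * (n - c)"
      using i(3) j(2) assms(2,4) by simp
    have "int (wt T) = int n * int j - (int (c * j) - int i)"
      unfolding wtT using cn by (simp add: of_nat_diff right_diff_distrib mult.commute)
    then have dvd: "int n dvd int (c * j) - int i"
      using T(2) by (metis dvd_diff_right_iff dvd_triv_left int_dvd_int_iff)
    have "c * j \<le> c * (u + 1)"
      using j(1) by (rule mult_le_mono2)
    then have cj: "c * j < n + c"
      using n by simp
    show "T = {#} \<or> T = B"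
    proof (cases "c * j < n")
      case True
      then have "int (c * j) < int n"
        by (simp only: of_nat_less_iff)
      moreover have "int i < int n" "0 \<le> int (c * j)"
        using i(1) cn by simp_all
      ultimately have "int (c * j) - int i = 0"
        by (intro int_dvd_small[OF dvd]) linarith
      then have "c * j = i"
        by linarith
      then have "j = 0" "i = 0"
        using i(1) c by (cases j; simp)+
      then show ?thesis
        using i(3) j(2) by simp
    next
      case False
      have "int n dvd (int (c * j) - int i) - int n"
        using dvd by simp
      moreover have "\<bar>(int (c * j) - int i) - int n\<bar> < int n"
        using False cj i(1) cn by linarith
      ultimately have "(int (c * j) - int i) - int n = 0"
        by (rule int_dvd_small)
      then have e: "c * j = i + n"
        by linarith
      then have "c * u < c * j"
        using n by linarith
      then have "j = u + 1"
        using j(1) by simp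
      then have "i = c - 1"
        using e n by simp
      then show ?thesis
        using \<open>j = u + 1\<close> i(3) j(2) by (simp add: B_def)
    qed
  qed
  have "n + (c - 1) = (u + 1) * c"
    using n c by (simp add: mult.commute)
  then have "\<Sum>\<^sub># F = \<Sum>\<^sub># F'"
    unfolding F_def F'_def V_def B_def sum_mset_replicate_mset_add
    by (simp flip: replicate_mset_add add: add.assoc[symmetric])
  moreover have "set_mset F \<subseteq> atoms Z" "set_mset F' \<subseteq> atoms Z"
    using E B V by (auto simp: F_def F'_def)
  moreover have "size F' = size F + (u - 1)"
    using u by (simp add: F_def F'_def)
  ultimately show ?thesis
    unfolding has_distance_def by blast
qed

text \<open>With M = n / 2 the relation is (g e^M) (g h^M) = g^2 (e h)^M, of lengths 2 and M +
  1.\<close>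

lemma has_distance_involution:
  assumes "e \<in> X" "x e = 1" "h \<in> X" "x h = n - 1" "g \<in> X" "2 * x g = n" "2 < n"
  shows "has_distance (x g - 1) Z"
proof -
  define M where "M = x g"
  define U where "U = replicate_mset 1 g + replicate_mset M e"
  define V where "V = replicate_mset 1 g + replicate_mset M h"
  define W where "W = replicate_mset 1 e + replicate_mset 1 h"
  define F where "F = {#U, V#}"
  define F' where "F' = add_mset (replicate_mset 2 g) (replicate_mset M W)"
  have M: "n = 2 * M" "1 < M"
    using assms(6,7) by (simp_all add: M_def)
  have "U \<in> atoms Z" "W \<in> atoms Z" "replicate_mset 2 g \<in> atoms Z"
    using assms M unfolding U_def W_def by (auto intro!: atom_of_wt_eq simp flip: M_def)
  moreover have "V \<in> atoms Z"
  proof (rule atomsI)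
    show "set_mset V \<subseteq> X" "V \<noteq> {#}"
      using assms(3,5) by (auto simp: V_def)
    have e: "j * (n - 1) + j = j * n" for j
    proof -
      have "n = Suc (n - 1)"
        using M by simp
      then show ?thesis
        by (metis mult_Suc_right add.commute)
    qed
    have "wt V = M * n"
      using assms(4) e[of M] by (simp add: V_def M_def)
    then show "n dvd wt V"
      by simp
    fix T
    assume T: "T \<subseteq># V" "n dvd wt T"
    from T(1) obtain i T' where i: "i \<le> 1" "T' \<subseteq># replicate_mset M h"
        "T = replicate_mset i g + T'"
      unfolding V_def by (rule subset_replicate_mset_add)
    from i(2) obtain j where j: "j \<le> M" "T' = replicate_mset j h"
      by (elim msubseteq_replicate_msetE) auto
    have "wt T = i * M + j * (n - 1)"
      using i(3) j(2) assms(4) by (simp add: M_def)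
    then have "wt T + j = i * M + j * n"
      using e[of j] by simp
    then have wtT: "int (wt T) = (int (i * M) - int j) + int j * int n"
      by (metis (no_types, lifting) add_diff_cancel_right' diff_add_eq of_nat_add of_nat_mult)
    then have dvd: "int n dvd int (i * M) - int j"
      using T(2) by (metis dvd_add_left_iff dvd_triv_right int_dvd_int_iff)
    consider "i = 0" | "i = 1"
      using i(1) by linarith
    then show "T = {#} \<or> T = V"
    proof cases
      case 1
      then have "int (i * M) - int j = 0"
        using j(1) M by (intro int_dvd_small[OF dvd]) auto
      then show ?thesis
        using 1 i(3) j(2) by simp
    next
      case 2
      then have "int (i * M) - int j = 0"
        using j(1) M by (intro int_dvd_small[OF dvd]) auto
      then show ?thesis
        using 2 i(3) j(2) by (simp add: V_def)
    qed
  qed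
  moreover have "\<Sum>\<^sub># F = \<Sum>\<^sub># F'"
  proof -
    have "\<Sum>\<^sub># F' = replicate_mset 2 g + \<Sum>\<^sub># (replicate_mset M W)"
      by (simp add: F'_def)
    also have "\<dots> = replicate_mset 2 g + (replicate_mset (M * 1) e + replicate_mset (M * 1) h)"
      unfolding W_def sum_mset_replicate_mset_add ..
    finally show ?thesis
      by (simp add: F_def U_def V_def numeral_2_eq_2)
  qed
  moreover have "size F' = size F + (x g - 1)"
    using M by (simp add: F_def F'_def M_def)
  ultimately show ?thesis
    unfolding has_distance_def by (intro exI[of _ F] exI[of _ F']) (auto simp: F_def F'_def)
qed

end

lemma not_has_distance_of_lengths_cong:
  assumes "lengths_cong D Z" "0 < d" "d < D"
  shows "\<not> has_distance d Z"
proof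
  assume "has_distance d Z"
  then obtain F F' where F: "set_mset F \<subseteq> atoms Z" "set_mset F' \<subseteq> atoms Z" "\<Sum>\<^sub># F = \<Sum>\<^sub># F'"
      "size F' = size F + d"
    unfolding has_distance_def by blast
  have "[size F + d = size F] (mod D)"
    using lengths_congD[OF assms(1) F(1-3)] F(4) cong_sym by simp
  then have "D dvd d"
    by (simp add: cong_altdef_nat)
  then show False
    using assms(2,3) by (auto dest: dvd_imp_le)
qed

context weighting
begin

text \<open>
  The set \<open>{e, -e}\<close> alone has minimal distance \<open>n - 2\<close>, and \<open>{e, -2 e}\<close> has \<open>(n - 3) / 2\<close> for odd
  \<open>n\<close>. Adding elements replaces these values by divisors, and the next two lemmas say that the
  divisors \<open>(n - 2) / 3\<close>, \<open>(n - 2) / 4\<close> and \<open>(n - 3) / 4\<close> do not occur.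
\<close>

lemma not_has_distance_neg_1:
  assumes H: "lengths_cong d Z" and e: "e \<in> X" "x e = 1" and h: "h \<in> X" "x h = n - 1"
    and n: "n = 3 * d + 2 \<or> n = 4 * d + 2" and d: "3 \<le> d"
  shows "\<not> has_distance d Z"
proof -
  \<comment> \<open>X is confined to e, -e, 0 and, for n = 4 d + 2, the involution. The atom of k
    and x k terms -e has index x k, so x k = d j + 1; the unwanted j are refuted by atoms over {e,
    k}.\<close>
  have x: "x k = 1 \<or> x k = n - 1 \<or> x k = n \<or> n = 4 * d + 2 \<and> x k = 2 * d + 1" if k: "k \<in> X" for k
  proof (rule ccontr)
    assume not: "\<not> ?thesis"
    then have lt: "x k < n" "1 < x k"
      using x_le[OF k] x_pos[OF k] by auto
    have "[x k = 1] (mod d)"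
    proof -
      have "[wt ({#k#} + (replicate_mset (x k) h + replicate_mset 0 e)) div n = 1] (mod d)"
        using e h k lt n by (intro atom_wt_cong[OF H e] atom_neg(1)[of e h 1]) auto
      also have "wt ({#k#} + (replicate_mset (x k) h + replicate_mset 0 e)) = x k * n"
        using e h k lt n by (intro atom_neg(2)[of e h 1]) auto
      finally show ?thesis
        using n_pos by simp
    qed
    then have "d dvd x k - 1"
      using lt by (simp add: cong_1_nat_iff)
    then obtain j where j: "x k - 1 = d * j"
      by (auto elim: dvdE)
    then have xk: "x k = d * j + 1"
      using lt by linarith
    have ic: "index_cong d n (x k)"
      using H e k lt by (intro index_cong_weight) auto
    have "d * j < d * 5"
      using xk lt n d by linarith
    then have j4: "j < 5"
      by simp
    have "d * j \<noteq> 0"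
      using xk lt by linarith
    then have j_cases: "j = 1 \<or> j = 2 \<or> j = 3 \<or> j = 4"
      using j4 by (cases "j = 0") auto
    \<comment> \<open>For x k = d + 1 the remainder of n is d or d - 1, and twice this remainder
      reaches d + 1, which gives an atom of index 2. The other candidate is -(d + 1), with an atom
      of index 2 or 3.\<close>
    show False
      using n
    proof
      assume n3: "n = 3 * d + 2"
      consider "x k = d + 1" | "x k = 2 * d + 1"
        using j_cases xk not lt n3 by (elim disjE) auto
      then show False
      proof cases
        case 1
        then have "d dvd 1"
          using d n3 by (intro index_cong_pos[OF ic, of 2 d 1]) auto
        then show False using d by simp
      next
        case 2
        have "[2 = 1] (mod d)"
          using d n3 ic 2 by (intro index_cong_neg[of d n "d + 1" 2]) auto
        then show False using d by (simp add: cong_def)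
      qed
    next
      assume n4: "n = 4 * d + 2"
      consider "x k = d + 1" | "x k = 3 * d + 1"
        using j_cases xk not lt n4 by (elim disjE) auto
      then show False
      proof cases
        case 1
        then have "d dvd 1"
          using d n4 by (intro index_cong_pos[OF ic, of 3 "d - 1" 1]) auto
        then show False using d by simp
      next
        case 2
        have "[3 = 1] (mod d)"
          using d n4 ic 2 by (intro index_cong_neg[of d n "d + 1" 3]) auto
        then have "d dvd 2"
          using cong_1_nat_iff[of 3 d] by simp
        then show False using d by (auto dest: dvd_imp_le)
      qed
    qed
  qed
  \<comment> \<open>Over such a set the lengths agree modulo 3 d or 2 d, so the difference d cannot
    occur.\<close>
  show ?thesis
    using n
  proof
    assume n3: "n = 3 * d + 2"
    have "lengths_cong (3 * d) Z"
      using x n3 d by (intro lengths_cong_involution) auto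
    then show ?thesis
      using d by (intro not_has_distance_of_lengths_cong) auto
  next
    assume n4: "n = 4 * d + 2"
    have "2 * d dvd 4 * d"
      by (intro mult_dvd_mono) auto
    moreover have "x k = 1 \<or> x k = n - 1 \<or> x k = n \<or> 2 * x k = n \<and> 2 * d dvd x k - 1"
      if "k \<in> X" for k
      using x[OF that] n4 by auto
    ultimately have "lengths_cong (2 * d) Z"
      using n4 d by (intro lengths_cong_involution) auto
    then show ?thesis
      using d by (intro not_has_distance_of_lengths_cong) auto
  qed
qed

lemma not_has_distance_neg_2:
  assumes H: "lengths_cong d Z" and e: "e \<in> X" "x e = 1" and h: "h \<in> X" "x h = n - 2"
    and n: "n = 4 * d + 3" and d: "3 \<le> d"
  shows "\<not> has_distance d Z"
proof -
  have x: "x k = 1 \<or> x k = n - 2 \<or> x k = n" if k: "k \<in> X" for k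
  proof (rule ccontr)
    assume not: "\<not> ?thesis"
    then have lt: "x k < n" "1 < x k"
      using x_le[OF k] x_pos[OF k] by auto
    \<comment> \<open>m is x k / 2 rounded up, the index of the atom of k, m terms -2 e and s terms
      e.\<close>
    have half: "[m = 1] (mod d)" if "x k + s = 2 * m" "s < 2" for m s
    proof -
      have "x k + s < n"
        using that n lt by presburger
      then have "[wt ({#k#} + (replicate_mset m h + replicate_mset s e)) div n = 1] (mod d)"
        using e h k n that by (intro atom_wt_cong[OF H e] atom_neg(1)[of e h 2]) auto
      also have "wt ({#k#} + (replicate_mset m h + replicate_mset s e)) = m * n"
        using e h k n that \<open>x k + s < n\<close> by (intro atom_neg(2)[of e h 2]) auto
      finally show ?thesis
        using n_pos by simp
    qed
    have ic: "index_cong d n (x k)"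
      using H e k lt by (intro index_cong_weight) auto
    obtain m s where ms: "x k + s = 2 * m" "s < (2::nat)"
      by (metis dvd_def even_Suc_Suc_iff Suc_1 add.right_neutral add_Suc_right even_Suc less_2_cases_iff pos2)
    have m: "1 \<le> m"
      using ms lt by linarith
    then have "d dvd m - 1"
      using half[OF ms] by (simp add: cong_1_nat_iff)
    then obtain j where "m - 1 = d * j"
      by (auto elim: dvdE)
    then have mj: "m = d * j + 1"
      using m by linarith
    then have "d * j < d * 3"
      using ms lt n d by linarith
    then have "j = 0 \<or> j = 1 \<or> j = 2"
      by auto
    then consider "x k = 2" | "x k = 2 * d + 2" | "x k = 4 * d + 2" | "x k = 2 * d + 1"
    proof -
      have "s = 0 \<or> s = 1"
        using ms(2) by auto
      moreover have "x k = 2 * m - s" "x k \<noteq> 1" "x k \<noteq> n - 2" "x k < n"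
        using ms(1) not lt by auto
      ultimately show ?thesis
        using \<open>j = 0 \<or> j = 1 \<or> j = 2\<close> mj n that by auto
    qed
    then show False
    proof cases
      case 1
      then have "d dvd 1"
        using d n by (intro index_cong_pos[OF ic, of "2 * d + 1" 1 1]) auto
      then show False using d by simp
    next
      case 2
      have "[2 = 1] (mod d)"
        using d n ic 2 by (intro index_cong_neg[of d n "2 * d + 1" 2]) auto
      then show False using d by (simp add: cong_def)
    next
      case 3
      have "[4 * d + 2 = 1] (mod d)"
        using d n ic 3 by (intro index_cong_neg[of d n 1 "4 * d + 2"]) auto
      then have "d dvd 4 * d + 1"
        using cong_1_nat_iff[of "4 * d + 2" d] by simp
      then have "d dvd 1"
        by (metis dvd_add_right_iff dvd_triv_right)
      then show False using d by simp
    next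
      case 4
      \<comment> \<open>Here e = -2 k, and the pair {e, k} is consistent with d. The contradiction
        comes from {k, h}: with k as generator, h = -2 e = 4 k, and n = 4 d + 3 has remainder 3
        modulo 4.\<close>
      have "coprime (x k) n"
      proof (rule coprimeI)
        fix c
        assume "c dvd x k" "c dvd n"
        moreover have "n = 2 * x k + 1"
          using 4 n by simp
        ultimately have "c dvd 2 * x k" "c dvd 2 * x k + 1"
          by (simp_all only: dvd_mult)
        then show "is_unit c"
          by (metis dvd_add_right_iff)
      qed
      moreover have "[x k * 4 = x h] (mod n)"
      proof -
        have "x k * 4 = x h + n"
          using 4 h n by simp
        then show ?thesis
          by (simp add: cong_def)
      qed
      ultimately obtain x' where x': "weighting Z X n x'" "x' k = 1" "x' h = 4"
        using rebase_generator[OF k h(1), of 4] n d by auto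
      interpret x': weighting Z X n x'
        by (rule x')
      have ic': "index_cong d n 4"
        using x'.index_cong_weight[OF H k x'(2) h(1)] x'(3) n d by simp
      have "d dvd 1"
        using d n by (intro index_cong_pos[OF ic', of d 3 1]) auto
      then show False using d by simp
    qed
  qed
  have "lengths_cong (2 * d + 1 - 1) Z"
    using x n d by (intro lengths_cong_neg[of 2]) auto
  then show ?thesis
    using d by (intro not_has_distance_of_lengths_cong) auto
qed

end

section \<open>Large distances\<close>

context weighting
begin

text \<open>a is the quotient of the unit parts modulo t; it is congruent to 1 precisely when the
  two weights are compatible.\<close>

lemma ex_quotient:
  assumes "g \<in> X" "h \<in> X" and t: "t = gcd (ord_of n (x g)) (ord_of n (x h))"
  shows "\<exists>a. a < t \<and> [unit_of n (x g) * a = unit_of n (x h)] (mod t)"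
proof -
  have t0: "0 < t"
    using ord_of_pos[OF n_pos] by (simp add: t)
  have "coprime (unit_of n (x g)) t"
    using coprime_unit_of[OF n_pos, of "x g"] unfolding t
    by (metis coprime_divisors dvd_refl gcd_dvd1)
  then obtain v where v: "[unit_of n (x g) * v = 1] (mod t)"
    using cong_solve_coprime_nat by (metis One_nat_def)
  have "[unit_of n (x g) * (v * unit_of n (x h) mod t) = unit_of n (x g) * (v * unit_of n (x h))] (mod t)"
    by (intro cong_mult cong_refl) (simp add: cong_def)
  also have "[unit_of n (x g) * (v * unit_of n (x h)) = 1 * unit_of n (x h)] (mod t)"
    using cong_mult[OF v cong_refl[of "unit_of n (x h)"]] by (simp add: mult.assoc)
  finally show ?thesis
    using t0 by (intro exI[of _ "v * unit_of n (x h) mod t"]) simp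
qed

lemma quotient_pos:
  assumes "[unit_of n (x g) * a = unit_of n (x h)] (mod t)" "t dvd ord_of n (x h)" "1 < t"
  shows "0 < a"
proof (rule gr0I)
  assume "a = 0"
  then have "[unit_of n (x h) = 0] (mod t)"
    using assms(1) by (simp add: cong_sym_eq)
  then have "t dvd unit_of n (x h)"
    by (simp add: cong_0_iff)
  then have "is_unit t"
    using coprime_unit_of[OF n_pos, of "x h"] assms(2) by (metis coprime_def)
  then show False
    using assms(3) by simp
qed

lemma index_cong_of_quotient:
  assumes H: "lengths_cong d Z" and gh: "g \<in> X" "h \<in> X" "g \<noteq> h"
    and t: "t = gcd (ord_of n (x g)) (ord_of n (x h))" and "1 < t"
    and a: "a < t" "[unit_of n (x g) * a = unit_of n (x h)] (mod t)"
  shows "index_cong d t a"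
proof (rule index_cong_pair[OF H gh])
  have "0 < ord_of n (x g)" "0 < ord_of n (x h)"
    using ord_of_pos[OF n_pos] by auto
  then show "0 < ord_of n (x g) div t" "0 < ord_of n (x h) div t"
    unfolding t by (simp_all add: div_greater_zero_iff gcd_le1_nat gcd_le2_nat)
  show "0 < a"
    using quotient_pos[OF a(2) _ \<open>1 < t\<close>] by (simp add: t)
  show "n dvd i * x g + j * x h \<longleftrightarrow> (\<exists>i' j'. i = ord_of n (x g) div t * i' \<and>
      j = ord_of n (x h) div t * j' \<and> t dvd i' + a * j')" for i j
    by (rule zero_sum_pair_iff[OF n_pos t a(2)])
qed (rule a)

text \<open>In the spurious cases t = n, so g and h both have order n, and g can be made the
  generator with h = -c g.\<close>

lemma not_has_distance_of_pair:
  assumes H: "lengths_cong d Z" and gh: "g \<in> X" "h \<in> X"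
    and ord: "n = ord_of n (x g)"
    and a: "[unit_of n (x g) * (n - c) = unit_of n (x h)] (mod n)"
    and c: "c = 1 \<and> (n = 3 * d + 2 \<or> n = 4 * d + 2) \<or> c = 2 \<and> n = 4 * d + 3" and d: "3 \<le> d"
    and ord': "n = ord_of n (x h)"
  shows "\<not> has_distance d Z"
proof -
  have "gcd (x k) n = 1" if "n = ord_of n (x k)" for k
  proof -
    have "gcd (x k) n * n = n"
      using ord_of_mult[of "x k" n] unfolding that[symmetric] .
    then show ?thesis
      using n_pos by simp
  qed
  then have "gcd (x g) n = 1" "gcd (x h) n = 1"
    using ord ord' by blast+
  then have "coprime (x g) n" "[x g * (n - c) = x h] (mod n)"
    using a by (simp_all add: unit_of_def coprime_iff_gcd_eq_1)
  then obtain x' where x': "weighting Z X n x'" "x' g = 1" "x' h = n - c"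
    using rebase_generator[OF gh, of "n - c"] c d by auto
  interpret x': weighting Z X n x'
    by (rule x')
  show ?thesis
    using c
  proof
    assume "c = 1 \<and> (n = 3 * d + 2 \<or> n = 4 * d + 2)"
    then show ?thesis
      using x'.not_has_distance_neg_1[OF H gh(1) x'(2) gh(2)] x'(3) d by simp
  next
    assume "c = 2 \<and> n = 4 * d + 3"
    then show ?thesis
      using x'.not_has_distance_neg_2[OF H gh(1) x'(2) gh(2)] x'(3) d by simp
  qed
qed

lemma distance_cases:
  assumes H: "lengths_cong d Z" and dist: "has_distance d Z" and n: "n \<le> 5 * d" "150 \<le> n"
  shows "n \<in> {d + 2, 2 * d + 2, 2 * d + 3, 2 * d + 4, 3 * d + 4, 3 * d + 6,
    4 * d + 4, 4 * d + 5, 4 * d + 6, 4 * d + 8}"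
proof -
  have d: "30 \<le> d"
    using n by linarith
  obtain g h where gh: "g \<in> X" "h \<in> X" "\<not> compatible n (x g) (x h)"
    using half_factorial_of_compatible[OF _ H n] dist d by force
  have "g \<noteq> h"
    using gh(3) by (auto simp: compatible_def)
  define t where "t = gcd (ord_of n (x g)) (ord_of n (x h))"
  have t': "t = gcd (ord_of n (x h)) (ord_of n (x g))"
    by (simp add: t_def gcd.commute)
  have "0 < t"
    using ord_of_pos[OF n_pos] by (simp add: t_def)
  moreover have "t \<noteq> 1"
    using gh(3) by (auto simp: compatible_def t_def cong_def)
  ultimately have t1: "1 < t"
    by linarith
  obtain a where a: "a < t" "[unit_of n (x g) * a = unit_of n (x h)] (mod t)"
    using ex_quotient[OF gh(1,2) t_def] by blast
  obtain b where b: "b < t" "[unit_of n (x h) * b = unit_of n (x g)] (mod t)"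
    using ex_quotient[OF gh(2,1) t'] by blast
  have cop: "coprime (unit_of n (x g)) t"
    using coprime_unit_of[OF n_pos, of "x g"] unfolding t_def
    by (metis coprime_divisors dvd_refl gcd_dvd1)
  have "[unit_of n (x g) * (a * b) = unit_of n (x h) * b] (mod t)"
    using cong_mult[OF a(2) cong_refl[of b]] by (simp add: mult.assoc)
  then have "[unit_of n (x g) * (a * b) = unit_of n (x g) * 1] (mod t)"
    using b(2) cong_trans by fastforce
  then have ab: "[a * b = 1] (mod t)"
    by (simp only: cong_mult_lcancel_nat[OF cop])
  have ica: "index_cong d t a"
    by (rule index_cong_of_quotient[OF H gh(1,2) \<open>g \<noteq> h\<close> t_def t1 a])
  have icb: "index_cong d t b"
    by (rule index_cong_of_quotient[OF H gh(2,1) \<open>g \<noteq> h\<close>[symmetric] t' t1 b])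
  have "a \<noteq> 1"
    using a(2) gh(3) by (auto simp: compatible_def t_def)
  moreover have "0 < a"
    using quotient_pos[OF a(2) _ t1] by (simp add: t_def)
  ultimately have a1: "1 < a"
    by linarith
  have "t dvd n"
    using ord_of_mult[of "x g" n] by (metis dvd_trans dvd_triv_right gcd_dvd1 t_def)
  then obtain q where q: "n = q * t"
    by (metis dvd_def mult.commute)
  then have "0 < q"
    using n_pos by (cases q) auto
  then have "t \<le> n"
    using q by simp
  then have t5: "t \<le> 5 * d"
    using n by linarith
  have "coprime a t"
    using ab by (metis cong_imp_coprime cong_sym coprime_1_left coprime_mult_left_iff)
  then have "[a = 1] (mod d)"
    using index_cong_self[OF ica] t1 by simp
  then have "d dvd a - 1"
    using a1 by (simp add: cong_1_nat_iff)
  then have "d \<le> a - 1"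
    using a1 by (simp add: dvd_imp_le)
  then have dt: "d + 2 \<le> t"
    using a1 a(1) by linarith
  from pair_classification[OF ica icb ab a1 a(1) b(1) t5] d
  consider "t = 4 * d + 4"
    | c where "0 < c" "c \<le> 4" "a = t - c \<or> b = t - c" "c * d dvd t - c - 1"
    by auto
  then show ?thesis
  proof cases
    case 1
    have "q = 1"
    proof (rule ccontr)
      assume "q \<noteq> 1"
      then have "2 * t \<le> n"
        using q \<open>0 < q\<close> by simp
      then show False
        using 1 n(1) d by linarith
    qed
    then show ?thesis
      using q 1 by simp
  next
    case c: 2
    obtain j where j: "t - c - 1 = c * d * j"
      using c(4) by (auto elim: dvdE)
    then have tj: "t = c * d * j + c + 1"
      using dt d c(2) by linarith
    have "0 < j"
      using j dt d c(2) by (cases j) auto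
    \<comment> \<open>q is the index of the subgroup of order t. The last summand is positive, so n
      \<le> 5 d leaves only q c j \<le> 4.\<close>
    have nq: "n = (q * c * j) * d + q * (c + 1)"
      unfolding q tj by (simp add: algebra_simps)
    moreover have "0 < q * (c + 1)"
      using \<open>0 < q\<close> by simp
    ultimately have "(q * c * j) * d < 5 * d"
      using n(1) by linarith
    then have small: "q * c * j < 5"
      by simp
    \<comment> \<open>The triples (q, c, j) = (1, 1, 3), (1, 1, 4) and (1, 2, 2) would give 3 d + 2,
      4 d + 2 and 4 d + 3. The other ten triples with q c j \<le> 4 give the listed values.\<close>
    have "\<not> (q = 1 \<and> (c = 1 \<and> (j = 3 \<or> j = 4) \<or> c = 2 \<and> j = 2))"
    proof
      assume bad: "q = 1 \<and> (c = 1 \<and> (j = 3 \<or> j = 4) \<or> c = 2 \<and> j = 2)"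
      then have tn: "t = n"
        using q by simp
      have cn: "c = 1 \<and> (n = 3 * d + 2 \<or> n = 4 * d + 2) \<or> c = 2 \<and> n = 4 * d + 3"
        using bad tj tn by auto
      have "ord_of n (x k) dvd n" for k
        using ord_of_mult[of "x k" n] by (metis dvd_triv_right)
      moreover have "t dvd ord_of n (x g)" "t dvd ord_of n (x h)"
        by (simp_all add: t_def)
      then have "n dvd ord_of n (x g)" "n dvd ord_of n (x h)"
        by (simp_all only: tn)
      ultimately have ord: "n = ord_of n (x g)" "n = ord_of n (x h)"
        using dvd_antisym by blast+
      have "\<not> has_distance d Z"
        using c(3)
      proof
        assume "a = t - c"
        then show ?thesis
          using not_has_distance_of_pair[OF H gh(1,2) ord(1) _ cn _ ord(2)] a(2) tn d by simp
      next
        assume "b = t - c"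
        then show ?thesis
          using not_has_distance_of_pair[OF H gh(2,1) ord(2) _ cn _ ord(1)] b(2) tn d by simp
      qed
      then show False
        using dist by contradiction
    qed
    moreover have "q \<le> q * c * j" "c \<le> q * c * j" "j \<le> q * c * j"
      using \<open>0 < q\<close> \<open>0 < j\<close> c(1) by simp_all
    then have "q < 5" "c < 5" "j < 5"
      using small by linarith+
    then have "q \<in> {1, 2, 3, 4}" "c \<in> {1, 2, 3, 4}" "j \<in> {1, 2, 3, 4}"
      using \<open>0 < q\<close> \<open>0 < j\<close> c(1) by auto
    ultimately show ?thesis
      using small nq by (elim insertE emptyE) simp_all
  qed
qed

end

section \<open>Discrete logarithms in a cyclic group and the attained values\<close>

lemma sum_mset_eq_sum_count: "(\<Sum>g\<in>#S. f g) = (\<Sum>g\<in>set_mset S. count S g * f g)" for f :: "'a \<Rightarrow> nat"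
proof -
  have "(\<Sum>g\<in>#T. f g) = (\<Sum>g\<in>set_mset S. count T g * f g)" if "set_mset T \<subseteq> set_mset S" for T
    using that
  proof (induction T)
    case (add a T)
    have "(\<Sum>g\<in>set_mset S. count (add_mset a T) g * f g) =
        (\<Sum>g\<in>set_mset S. count T g * f g + (if g = a then f g else 0))"
      by (intro sum.cong) auto
    also have "\<dots> = (\<Sum>g\<in>set_mset S. count T g * f g) + f a"
      using add.prems by (simp add: sum.distrib)
    finally show ?case
      using add by simp
  qed simp
  then show ?thesis
    by blast
qed

text \<open>x is the discrete logarithm to a generator e, with values in 1, ..., n. It is chosen
  once for the whole group, so that one function serves all subsets X.\<close>

lemma (in group) ex_weighting:
  assumes "cyclic_group G" "finite (carrier G)"
  obtains x where "\<And>X. X \<subseteq> carrier G \<Longrightarrow> weighting (zero_sum_seqs G X) X (order G) x"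
    and "\<And>k. 0 < k \<Longrightarrow> k \<le> order G \<Longrightarrow> \<exists>g\<in>carrier G. x g = k"
proof -
  define n where "n = order G"
  interpret comm_group G
    using assms(1) cyclic_imp_abelian_group by blast
  obtain e where e: "e \<in> carrier G" "subgroup_generated G {e} = G"
    using assms(1) unfolding cyclic_group_def by blast
  have carrier: "carrier G = range (\<lambda>k::int. e [^] k)"
    using carrier_subgroup_generated_by_singleton[OF e(1)] e(2) by simp
  have n0: "0 < n"
    unfolding n_def using assms(2) order_gt_0_iff_finite by blast
  have "ord e = n"
    using cyclic_order_is_ord[OF e(1)] e(2) by (simp add: n_def)
  have pow_eq: "e [^] k = \<one> \<longleftrightarrow> n dvd k" for k :: nat
    using pow_eq_id[OF e(1)] \<open>ord e = n\<close> by simp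
  have ex: "\<exists>k. 0 < k \<and> k \<le> n \<and> e [^] k = g" if "g \<in> carrier G" for g
  proof -
    obtain m :: int where m: "g = e [^] m"
      using \<open>g \<in> carrier G\<close> carrier by blast
    define k where "k = (if int n dvd m then n else nat (m mod int n))"
    have "0 < m mod int n" if "\<not> int n dvd m"
    proof -
      have "m mod int n \<noteq> 0"
        using that by (simp only: dvd_eq_mod_eq_0 not_False_eq_True)
      moreover have "0 \<le> m mod int n"
        using n0 by simp
      ultimately show ?thesis
        by linarith
    qed
    moreover have "m mod int n < int n"
      using n0 by simp
    ultimately have "0 < k" "k \<le> n" "int n dvd m - int k"
      using n0 by (auto simp: k_def nat_le_iff less_imp_le mod_eq_dvd_iff[symmetric])
    moreover from this(3) have "e [^] int k = e [^] m"
      using int_pow_eq[OF e(1)] \<open>ord e = n\<close> by simp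
    then have "e [^] k = g"
      using m by (simp add: int_pow_int)
    ultimately show ?thesis
      by blast
  qed
  define x where "x g = (SOME k. 0 < k \<and> k \<le> n \<and> e [^] k = g)" for g
  have x: "0 < x g" "x g \<le> n" "e [^] x g = g" if "g \<in> carrier G" for g
    using someI_ex[OF ex[OF that]] unfolding x_def by auto
  have sum: "seq_sum G S = e [^] (\<Sum>g\<in>#S. x g)" if "set_mset S \<subseteq> carrier G" for S
  proof -
    have "finprod G (\<lambda>g. g [^] count S g) A = e [^] (\<Sum>g\<in>A. count S g * x g)"
      if "finite A" "A \<subseteq> carrier G" for A
      using that
    proof (induction A)
      case (insert g A)
      have "g [^] count S g = e [^] (count S g * x g)"
        using x(3)[of g] insert.prems e(1) nat_pow_pow[OF e(1), of "x g" "count S g"]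
        by (simp add: mult.commute)
      moreover have "(\<lambda>g. g [^] count S g) \<in> A \<rightarrow> carrier G"
        using insert.prems by auto
      ultimately show ?case
        using insert e(1) by (simp add: nat_pow_mult)
    qed simp
    then show ?thesis
      using that by (simp add: seq_sum_def sum_mset_eq_sum_count)
  qed
  have pow_inj: "k = l" if "e [^] k = e [^] l" "0 < k" "k \<le> n" "0 < l" "l \<le> n" for k l :: nat
  proof -
    have "e [^] int k = e [^] int l"
      using that(1) by (simp add: int_pow_int)
    then have "int n dvd int l - int k"
      using int_pow_eq[OF e(1)] \<open>ord e = n\<close> by simp
    then have "int l - int k = 0"
      using that(2-) by (intro int_dvd_small) auto
    then show "k = l"
      by simp
  qed
  show ?thesis
  proof (rule that[of x])
    fix X
    assume X: "X \<subseteq> carrier G"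
    have "zero_sum_seqs G X = {S. set_mset S \<subseteq> X \<and> n dvd (\<Sum>g\<in>#S. x g)}"
      using sum X pow_eq unfolding zero_sum_seqs_def by auto
    moreover have "inj_on x X"
      using x(3) X by (metis inj_onI subsetD)
    ultimately show "weighting (zero_sum_seqs G X) X (order G) x"
      using x X n0 unfolding n_def[symmetric] by unfold_locales auto
  next
    fix k
    assume k: "0 < k" "k \<le> order G"
    have "x (e [^] k) = k"
      using x[of "e [^] k"] e(1) k by (intro pow_inj) (auto simp: n_def)
    then show "\<exists>g\<in>carrier G. x g = k"
      using e(1) by blast
  qed
qed

context weighting
begin

lemma empty_mem: "{#} \<in> Z"
  by (simp add: Z_eq)

lemma add_mem: "S \<in> Z \<Longrightarrow> T \<in> Z \<Longrightarrow> S + T \<in> Z"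
  by (auto simp: Z_eq)

end

lemma Delta_star_iff:
  assumes "\<And>X. X \<subseteq> carrier G \<Longrightarrow> weighting (zero_sum_seqs G X) X n x" "0 < d"
  shows "d \<in> Delta_star G \<longleftrightarrow>
    (\<exists>X\<subseteq>carrier G. lengths_cong d (zero_sum_seqs G X) \<and> has_distance d (zero_sum_seqs G X))"
proof -
  have "Delta G X \<noteq> {} \<and> min_Delta G X = d \<longleftrightarrow>
      lengths_cong d (zero_sum_seqs G X) \<and> has_distance d (zero_sum_seqs G X)"
    if "X \<subseteq> carrier G" for X
    using weighting.empty_mem[OF assms(1)[OF that]] weighting.add_mem[OF assms(1)[OF that]] assms(2)
    by (intro min_Delta_eq_iff)
  then show ?thesis
    unfolding Delta_star_def by blast
qed

locale weighted_group =
  fixes G :: "('a, 'b) monoid_scheme" and n :: nat and x :: "'a \<Rightarrow> nat"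
  assumes weighting: "\<And>X. X \<subseteq> carrier G \<Longrightarrow> weighting (zero_sum_seqs G X) X n x"
    and surj: "\<And>k. 0 < k \<Longrightarrow> k \<le> n \<Longrightarrow> \<exists>g\<in>carrier G. x g = k"
begin

text \<open>In the subgroup of order N = c u + 1 and index q, the weights q and q (N - c) stand for
  a generator e and for -c e. For d = u - 1 the hypothesis reads n = q c d + q (c + 1).\<close>

lemma neg_mem_Delta_star:
  assumes n: "n = q * (c * u + 1)" and "0 < q" "0 < c" "2 \<le> u"
  shows "u - 1 \<in> Delta_star G"
proof -
  define N where "N = c * u + 1"
  have "c * 2 \<le> c * u"
    using assms(4) by (rule mult_le_mono2)
  then have cN: "c < N"
    using assms(3) unfolding N_def by linarith
  have "q * (N - c) \<le> q * N"
    by (rule mult_le_mono2) simp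
  moreover have "q * 1 \<le> q * N" "0 < q * (N - c)"
    using assms(2) cN by (simp_all add: N_def)
  ultimately obtain e h where eh: "e \<in> carrier G" "x e = q" "h \<in> carrier G" "x h = q * (N - c)"
    using surj[of q] surj[of "q * (N - c)"] assms(2) unfolding n N_def[symmetric] by auto
  define X where "X = {e, h}"
  interpret W: weighting "zero_sum_seqs G X" X n x
    using eh by (intro weighting) (auto simp: X_def)
  have "weighting (zero_sum_seqs G X) X N (\<lambda>k. x k div q)"
    using n eh by (intro W.weighting_div) (auto simp: X_def N_def)
  then interpret V: weighting "zero_sum_seqs G X" X N "\<lambda>k. x k div q" .
  have xe: "x e div q = 1" "x h div q = N - c"
    using eh assms(2) by simp_all
  have "lengths_cong (u - 1) (zero_sum_seqs G X)"
    using xe assms by (intro V.lengths_cong_neg[of c]) (auto simp: X_def N_def)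
  moreover have "has_distance (u - 1) (zero_sum_seqs G X)"
    using xe assms by (intro V.has_distance_neg[of e h c]) (auto simp: X_def N_def)
  ultimately show ?thesis
    using Delta_star_iff[OF weighting, of "u - 1"] assms(4) eh by (auto simp: X_def)
qed

lemma involution_mem_Delta_star:
  assumes n: "n = q * (2 * m)" and "0 < q" "1 < m"
  shows "m - 1 \<in> Delta_star G"
proof -
  define N where "N = 2 * m"
  have "0 < q * 1" "q * 1 \<le> q * N" "0 < q * (N - 1)" "q * (N - 1) \<le> q * N" "0 < q * m" "q * m \<le> q * N"
    using assms(2,3) by (simp_all add: N_def)
  then obtain e h g where eh: "e \<in> carrier G" "x e = q" "h \<in> carrier G" "x h = q * (N - 1)"
      "g \<in> carrier G" "x g = q * m"
    using surj[of q] surj[of "q * (N - 1)"] surj[of "q * m"] unfolding n N_def[symmetric] by auto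
  define X where "X = {e, h, g}"
  interpret W: weighting "zero_sum_seqs G X" X n x
    using eh by (intro weighting) (auto simp: X_def)
  have "weighting (zero_sum_seqs G X) X N (\<lambda>k. x k div q)"
    using n eh by (intro W.weighting_div) (auto simp: X_def N_def)
  then interpret V: weighting "zero_sum_seqs G X" X N "\<lambda>k. x k div q" .
  have xe: "x e div q = 1" "x h div q = N - 1" "x g div q = m"
    using eh assms(2) by simp_all
  have "N - 2 = (m - 1) * 2"
    by (simp add: N_def)
  then have "m - 1 dvd N - 2"
    by simp
  then have "lengths_cong (m - 1) (zero_sum_seqs G X)"
    using xe assms by (intro V.lengths_cong_involution) (auto simp: X_def N_def)
  moreover have "has_distance (x g div q - 1) (zero_sum_seqs G X)"
    using xe assms by (intro V.has_distance_involution[of e h g]) (auto simp: X_def N_def)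
  ultimately show ?thesis
    using Delta_star_iff[OF weighting, of "m - 1"] assms(3) eh xe by (auto simp: X_def)
qed

lemma large_mem_Delta_star_iff:
  assumes "250 \<le> n" "0 < d"
  shows "d \<in> Delta_star G \<and> n \<le> 5 * d \<longleftrightarrow> n \<in> {d + 2, 2 * d + 2, 2 * d + 3, 2 * d + 4, 3 * d + 4,
    3 * d + 6, 4 * d + 4, 4 * d + 5, 4 * d + 6, 4 * d + 8}"
proof (intro iffI conjI)
  assume "d \<in> Delta_star G \<and> n \<le> 5 * d"
  then obtain X where X: "X \<subseteq> carrier G" "lengths_cong d (zero_sum_seqs G X)"
      "has_distance d (zero_sum_seqs G X)" "n \<le> 5 * d"
    using Delta_star_iff[OF weighting assms(2)] by blast
  interpret weighting "zero_sum_seqs G X" X n x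
    using X(1) by (rule weighting)
  show "n \<in> {d + 2, 2 * d + 2, 2 * d + 3, 2 * d + 4, 3 * d + 4,
      3 * d + 6, 4 * d + 4, 4 * d + 5, 4 * d + 6, 4 * d + 8}"
    using X assms(1) by (intro distance_cases) auto
next
  assume "n \<in> {d + 2, 2 * d + 2, 2 * d + 3, 2 * d + 4, 3 * d + 4,
      3 * d + 6, 4 * d + 4, 4 * d + 5, 4 * d + 6, 4 * d + 8}"
  \<comment> \<open>Eight of the values have the form q c d + q (c + 1) and come from {e, -c e}; 2 d
    + 2 and 4 d + 4 come from the involution with q = 1 and q = 2.\<close>
  then show "d \<in> Delta_star G"
    using assms(2) neg_mem_Delta_star[of 1 1 "d + 1"] neg_mem_Delta_star[of 1 2 "d + 1"]
      neg_mem_Delta_star[of 2 1 "d + 1"] neg_mem_Delta_star[of 1 3 "d + 1"]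
      neg_mem_Delta_star[of 3 1 "d + 1"] neg_mem_Delta_star[of 1 4 "d + 1"]
      neg_mem_Delta_star[of 2 2 "d + 1"] neg_mem_Delta_star[of 4 1 "d + 1"]
      involution_mem_Delta_star[of 1 "d + 1"] involution_mem_Delta_star[of 2 "d + 1"]
    by (elim insertE emptyE) simp_all
  \<comment> \<open>Each listed n is at most 4 d + 8, and 250 \<le> n makes d large enough for 4 d +
    8 \<le> 5 d.\<close>
  show "n \<le> 5 * d"
    using \<open>n \<in> _\<close> assms(1) by (elim insertE emptyE) simp_all
qed

end

theorem theorem2p1:
  fixes G :: "('a, 'b) monoid_scheme"
  assumes "group G" and "cyclic_group G" and "finite (carrier G)" and "order G \<ge> 250"
  shows "Delta_star G \<inter> {k. 0 < k \<and> real k \<ge> real (order G) / 5} =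
    (let n = real (order G) in
      {k. 0 < k \<and> real k \<in>
        {n - 2, (n - 2) / 2, (n - 3) / 2, (n - 4) / 2, (n - 4) / 3, (n - 6) / 3,
         (n - 4) / 4, (n - 5) / 4, (n - 6) / 4, (n - 8) / 4}})"
proof -
  define n where "n = order G"
  obtain x where "\<And>X. X \<subseteq> carrier G \<Longrightarrow> weighting (zero_sum_seqs G X) X n x"
      "\<And>k. 0 < k \<Longrightarrow> k \<le> n \<Longrightarrow> \<exists>g\<in>carrier G. x g = k"
    using group.ex_weighting[OF assms(1-3)] unfolding n_def by blast
  then interpret weighted_group G n x
    by (rule weighted_group.intro)
  have "real k \<in> {real n - 2, (real n - 2) / 2, (real n - 3) / 2, (real n - 4) / 2,
      (real n - 4) / 3, (real n - 6) / 3, (real n - 4) / 4, (real n - 5) / 4, (real n - 6) / 4,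
      (real n - 8) / 4} \<longleftrightarrow>
    n \<in> {k + 2, 2 * k + 2, 2 * k + 3, 2 * k + 4, 3 * k + 4,
      3 * k + 6, 4 * k + 4, 4 * k + 5, 4 * k + 6, 4 * k + 8}" for k
  proof -
    \<comment> \<open>As k is a natural number, equality with such a fraction already contains the
      divisibility expressed by the intersection with the natural numbers.\<close>
    have "real k = (real n - real a) / real b \<longleftrightarrow> n = b * k + a" if "0 < b" for a b
    proof -
      have "real k = (real n - real a) / real b \<longleftrightarrow> real n = real (b * k + a)"
        using that by (auto simp: field_simps)
      then show ?thesis
        by (simp only: of_nat_eq_iff)
    qed
    from this[of 1 2] this[of 2 2] this[of 2 3] this[of 2 4] this[of 3 4] this[of 3 6]
      this[of 4 4] this[of 4 5] this[of 4 6] this[of 4 8]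
    show ?thesis
      by simp
  qed
  moreover have "real n / 5 \<le> real k \<longleftrightarrow> n \<le> 5 * k" for k
    by linarith
  ultimately show ?thesis
    using large_mem_Delta_star_iff assms(4) unfolding n_def[symmetric] Let_def by auto
qed

end
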